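(* Let $F:(M_1,g_1)\to(M_2,g_2)$ be a Riemannian map between Riemannian manifolds $M_1$ and $M_2$, and let $H_2$ be the mean curvature vector field of $\operatorname{range}F_*$. Then $F$ is pseudo-umbilical if and only if $$g_2((\nabla F_* )(X,Y),H_2)=g_1(X,Y)\,g_2(H_2,H_2)$$ for all $X,Y\in\Gamma((\ker F_* )^\perp)$.
   Context: All manifolds and maps are smooth. A smooth map $F:(M_1,g_1)\to(M_2,g_2)$ of Riemannian manifolds with $\operatorname{rank}F>0$ is a Riemannian map if at every $p\in M_1$ the restriction of $F_{*p}$ to $(\ker F_{*p})^\perp$ is a linear isometry onto $\operatorname{range}F_{*p}\subset T_{F(p)}M_2$. Isometric immersions and Riemannian submersions are special cases. $(\operatorname{range}F_* )^\perp$ is the orthogonal complement of $\operatorname{range}F_*$ in $F^{-1}TM_2$; $m_2=\operatorname{rank}F$ (constant). $\nabla$ is the Levi-Civita connection of $M_1$ and $\nabla^F$ is the pullback to $F^{-1}TM_2$ of that of $M_2$. The second fundamental form is $(\nabla F_* )(X,Y)=\nabla^F_XF_*(Y)-F_*(\nabla_XY)$; it takes values in $(\operatorname{range}F_* )^\perp$ for $X,Y\in\Gamma((\ker F_* )^\perp)$. $H_2=\frac1{m_2}\sum_{i=1}^{m_2}(\nabla F_* )(e_i,e_i)$ for a local orthonormal frame $\{e_i\}$ of $(\ker F_* )^\perp$; it is a section of $(\operatorname{range}F_* )^\perp$. For a section $V$ of $(\operatorname{range}F_* )^\perp$ and $X\in\Gamma((\ker F_* )^\perp)$, $A_VF_*X$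 is minus the $\operatorname{range}F_*$-component of $\nabla^F_XV$. $F$ is pseudo-umbilical if there is $\lambda\in C^\infty(M_1)$ with $A_{H_2}F_*(X)=\lambda F_*(X)$ for all $X\in\Gamma((\ker F_* )^\perp)$. *)

theory Defs
  imports "HOL-Analysis.Analysis"
begin

section \<open>Smooth maps between Euclidean spaces\<close>

text \<open>Only used for open \<open>S\<close>. Class C^k is phrased through all directional derivatives, so that
  the derivatives of \<open>f\<close> have the same type as \<open>f\<close>.\<close>

fun Ck_on :: "nat \<Rightarrow> 'n::euclidean_space set \<Rightarrow> ('n \<Rightarrow> 'e::real_normed_vector) \<Rightarrow> bool" where
  "Ck_on 0 S f \<longleftrightarrow> continuous_on S f"
| "Ck_on (Suc k) S f \<longleftrightarrow>
     (\<forall>x\<in>S. f differentiable (at x)) \<and> (\<forall>v. Ck_on k S (\<lambda>x. frechet_derivative f (at x) v))"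

definition smooth_on :: "'n::euclidean_space set \<Rightarrow> ('n \<Rightarrow> 'e::real_normed_vector) \<Rightarrow> bool" where
  "smooth_on S f \<longleftrightarrow> (\<forall>k. Ck_on k S f)"

section \<open>Smooth manifolds, tangent vectors and vector fields\<close>

type_synonym ('a, 'n) chart = "'a set \<times> ('a \<Rightarrow> 'n)"

record ('a, 'n) riem =
  mtop :: "'a topology"
  atlas :: "('a, 'n) chart set"
  metric :: "'a \<Rightarrow> 'n \<Rightarrow> 'n \<Rightarrow> real"

abbreviation pts :: "('a, 'n) riem \<Rightarrow> 'a set" where
  "pts M \<equiv> topspace (mtop M)"

abbreviation chart_inv :: "('a, 'n) chart \<Rightarrow> 'n \<Rightarrow> 'a" where
  "chart_inv c \<equiv> inv_into (fst c) (snd c)"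

definition is_chart :: "'a topology \<Rightarrow> ('a, 'n::euclidean_space) chart \<Rightarrow> bool" where
  "is_chart T c \<longleftrightarrow> openin T (fst c) \<and> open (snd c ` fst c) \<and>
     homeomorphic_map (subtopology T (fst c)) (top_of_set (snd c ` fst c)) (snd c)"

text \<open>The atlas need not be maximal; all notions below depend only on the smooth structure it
  generates.\<close>

definition smooth_manifold :: "('a, 'n::euclidean_space) riem \<Rightarrow> bool" where
  "smooth_manifold M \<longleftrightarrow>
     Hausdorff_space (mtop M) \<and> second_countable (mtop M) \<and>
     (\<forall>c\<in>atlas M. is_chart (mtop M) c) \<and> \<Union> (fst ` atlas M) = pts M \<and>
     (\<forall>c\<in>atlas M. \<forall>d\<in>atlas M. smooth_on (snd c ` (fst c \<inter> fst d)) (snd d \<circ> chart_inv c))"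

definition smooth_fun ::
  "('a, 'n::euclidean_space) riem \<Rightarrow> 'a set \<Rightarrow> ('a \<Rightarrow> 'e::real_normed_vector) \<Rightarrow> bool" where
  "smooth_fun M W f \<longleftrightarrow> (\<forall>c\<in>atlas M. smooth_on (snd c ` (fst c \<inter> W)) (f \<circ> chart_inv c))"

definition smooth_map ::
  "('a, 'n::euclidean_space) riem \<Rightarrow> ('b, 'm::euclidean_space) riem \<Rightarrow> ('a \<Rightarrow> 'b) \<Rightarrow> bool" where
  "smooth_map M N F \<longleftrightarrow> continuous_map (mtop M) (mtop N) F \<and>
     (\<forall>d\<in>atlas N. smooth_fun M (pts M \<inter> F -` fst d) (snd d \<circ> F))"

text \<open>For each point \<open>p\<close> one chart around \<open>p\<close> is selected, and a tangent vector at \<open>p\<close> is given by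
  its coordinates \<open>v :: 'n\<close> in that chart, so that every \<open>T\<^sub>p M\<close> is the vector space
  \<open>'n\<close>. As the selected chart may jump from point to point, smoothness of a vector field is always
  tested on its coordinates in a fixed chart, see \<open>smooth_along\<close>.\<close>

definition chart_at :: "('a, 'n) riem \<Rightarrow> 'a \<Rightarrow> ('a, 'n) chart" where
  "chart_at M p = (SOME c. c \<in> atlas M \<and> p \<in> fst c)"

text \<open>\<open>differential M f p v\<close> is \<open>df\<^sub>p(v)\<close>, the derivative of the vector-valued function \<open>f\<close> in
  direction \<open>v \<in> T\<^sub>p M\<close>. In particular \<open>differential M (snd c) p v\<close> is the coordinate vector of
  \<open>v\<close> in an arbitrary chart \<open>c\<close> around \<open>p\<close>.\<close>

definition differential ::
  "('a, 'n::euclidean_space) riem \<Rightarrow> ('a \<Rightarrow> 'e::real_normed_vector) \<Rightarrow> 'a \<Rightarrow> 'n \<Rightarrow> 'e" where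
  "differential M f p v =
     frechet_derivative (f \<circ> chart_inv (chart_at M p)) (at (snd (chart_at M p) p)) v"

text \<open>\<open>pushforward M N F p\<close> is \<open>F\<^sub>*\<^sub>p : T\<^sub>p M \<rightarrow> T\<^sub>F\<^sub>(\<^sub>p\<^sub>) N\<close>.\<close>

definition pushforward ::
  "('a, 'n::euclidean_space) riem \<Rightarrow> ('b, 'm::euclidean_space) riem \<Rightarrow> ('a \<Rightarrow> 'b) \<Rightarrow> 'a \<Rightarrow> 'n \<Rightarrow> 'm" where
  "pushforward M N F p v = differential M (snd (chart_at N (F p)) \<circ> F) p v"

text \<open>\<open>smooth_along M N F W V\<close>: on the open set \<open>W\<close>, \<open>V\<close> is a smooth section of the pullback bundle
  \<open>F\<^sup>-\<^sup>1TN\<close>, that is, \<open>V q \<in> T\<^sub>F\<^sub>(\<^sub>q\<^sub>) N\<close> for \<open>q \<in> W\<close>. Vector fields are the case where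
  \<open>F\<close> is the identity.\<close>

definition smooth_along ::
  "('a, 'n::euclidean_space) riem \<Rightarrow> ('b, 'm::euclidean_space) riem \<Rightarrow> ('a \<Rightarrow> 'b) \<Rightarrow>
   'a set \<Rightarrow> ('a \<Rightarrow> 'm) \<Rightarrow> bool" where
  "smooth_along M N F W V \<longleftrightarrow>
     (\<forall>d\<in>atlas N. smooth_fun M (W \<inter> F -` fst d) (\<lambda>q. differential N (snd d) (F q) (V q)))"

abbreviation smooth_vf ::
  "('a, 'n::euclidean_space) riem \<Rightarrow> 'a set \<Rightarrow> ('a \<Rightarrow> 'n) \<Rightarrow> bool" where
  "smooth_vf M W X \<equiv> smooth_along M M (\<lambda>q. q) W X"

section \<open>Riemannian manifolds and connections\<close>

definition riemannian_manifold :: "('a, 'n::euclidean_space) riem \<Rightarrow> bool" where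
  "riemannian_manifold M \<longleftrightarrow> smooth_manifold M \<and>
     (\<forall>p\<in>pts M. bilinear (metric M p) \<and>
        (\<forall>v w. metric M p v w = metric M p w v) \<and>
        (\<forall>v. v \<noteq> 0 \<longrightarrow> 0 < metric M p v v)) \<and>
     (\<forall>U X Y. openin (mtop M) U \<and> smooth_vf M U X \<and> smooth_vf M U Y \<longrightarrow>
        smooth_fun M U (\<lambda>q. metric M q (X q) (Y q)))"

text \<open>A connection on \<open>F\<^sup>-\<^sup>1TN\<close>: \<open>D p v V\<close> is the covariant derivative at \<open>p\<close> of the section
  \<open>V\<close>, defined near \<open>p\<close>, in direction \<open>v \<in> T\<^sub>p M\<close>. The second conjunct says that this value depends
  only on the germ of \<open>V\<close> at \<open>p\<close>, so sections on open subsets can be differentiated although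
  \<open>V\<close> is a total function.\<close>

definition connection_along ::
  "('a, 'n::euclidean_space) riem \<Rightarrow> ('b, 'm::euclidean_space) riem \<Rightarrow> ('a \<Rightarrow> 'b) \<Rightarrow>
   ('a \<Rightarrow> 'n \<Rightarrow> ('a \<Rightarrow> 'm) \<Rightarrow> 'm) \<Rightarrow> bool" where
  "connection_along M N F D \<longleftrightarrow>
     (\<forall>U V. openin (mtop M) U \<and> smooth_along M N F U V \<longrightarrow>
        (\<forall>p\<in>U. linear (\<lambda>v. D p v V)) \<and>
        (\<forall>W. (\<forall>q\<in>U. W q = V q) \<longrightarrow> (\<forall>p\<in>U. \<forall>v. D p v W = D p v V)) \<and>
        (\<forall>W. smooth_along M N F U W \<longrightarrow>
           (\<forall>p\<in>U. \<forall>v. D p v (\<lambda>q. V q + W q) = D p v V + D p v W)) \<and>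
        (\<forall>f::'a \<Rightarrow> real. smooth_fun M U f \<longrightarrow>
           (\<forall>p\<in>U. \<forall>v. D p v (\<lambda>q. f q *\<^sub>R V q) = differential M f p v *\<^sub>R V p + f p *\<^sub>R D p v V)) \<and>
        (\<forall>X. smooth_vf M U X \<longrightarrow> smooth_along M N F U (\<lambda>q. D q (X q) V)))"

text \<open>The torsion condition \<open>\<nabla>\<^sub>XY - \<nabla>\<^sub>YX = [X,Y]\<close> is stated by applying both sides to functions
  \<open>f\<close>, with \<open>[X,Y]f = X(Yf) - Y(Xf)\<close>.\<close>

definition levi_civita ::
  "('a, 'n::euclidean_space) riem \<Rightarrow> ('a \<Rightarrow> 'n \<Rightarrow> ('a \<Rightarrow> 'n) \<Rightarrow> 'n) \<Rightarrow> bool" where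
  "levi_civita M D \<longleftrightarrow> connection_along M M (\<lambda>q. q) D \<and>
     (\<forall>U X Y. openin (mtop M) U \<and> smooth_vf M U X \<and> smooth_vf M U Y \<longrightarrow>
        (\<forall>f::'a \<Rightarrow> real. smooth_fun M U f \<longrightarrow> (\<forall>p\<in>U.
           differential M f p (D p (X p) Y - D p (Y p) X) =
             differential M (\<lambda>q. differential M f q (Y q)) p (X p)
             - differential M (\<lambda>q. differential M f q (X q)) p (Y p))) \<and>
        (\<forall>p\<in>U. \<forall>v. differential M (\<lambda>q. metric M q (X q) (Y q)) p v =
             metric M p (D p v X) (Y p) + metric M p (X p) (D p v Y)))"

text \<open>The pullback of \<open>D\<close> is the connection on \<open>F\<^sup>-\<^sup>1TN\<close> determined by the chain rule
  \<open>\<nabla>\<^sup>F\<^sub>v(Y \<circ> F) = D\<^bsub>F\<^sub>*v\<^esub> Y\<close> for local vector fields \<open>Y\<close> on \<open>N\<close>.\<close>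

definition pullback_connection ::
  "('a, 'n::euclidean_space) riem \<Rightarrow> ('b, 'm::euclidean_space) riem \<Rightarrow> ('a \<Rightarrow> 'b) \<Rightarrow>
   ('b \<Rightarrow> 'm \<Rightarrow> ('b \<Rightarrow> 'm) \<Rightarrow> 'm) \<Rightarrow> ('a \<Rightarrow> 'n \<Rightarrow> ('a \<Rightarrow> 'm) \<Rightarrow> 'm) \<Rightarrow> bool" where
  "pullback_connection M N F D DF \<longleftrightarrow> connection_along M N F DF \<and>
     (\<forall>W Y. openin (mtop N) W \<and> smooth_vf N W Y \<longrightarrow>
        (\<forall>p\<in>pts M. F p \<in> W \<longrightarrow>
           (\<forall>v. DF p v (\<lambda>q. Y (F q)) = D (F p) (pushforward M N F p v) Y)))"

section \<open>Riemannian maps\<close>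

text \<open>\<open>horizontal M N F p\<close> is \<open>(ker F\<^sub>*\<^sub>p)\<^sup>\<bottom>\<close>.\<close>

definition horizontal ::
  "('a, 'n::euclidean_space) riem \<Rightarrow> ('b, 'm::euclidean_space) riem \<Rightarrow> ('a \<Rightarrow> 'b) \<Rightarrow> 'a \<Rightarrow> 'n set" where
  "horizontal M N F p = {v. \<forall>w. pushforward M N F p w = 0 \<longrightarrow> metric M p v w = 0}"

definition map_rank ::
  "('a, 'n::euclidean_space) riem \<Rightarrow> ('b, 'm::euclidean_space) riem \<Rightarrow> ('a \<Rightarrow> 'b) \<Rightarrow> 'a \<Rightarrow> nat" where
  "map_rank M N F p = dim (range (pushforward M N F p))"

definition riemannian_map ::
  "('a, 'n::euclidean_space) riem \<Rightarrow> ('b, 'm::euclidean_space) riem \<Rightarrow> ('a \<Rightarrow> 'b) \<Rightarrow> bool" where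
  "riemannian_map M N F \<longleftrightarrow> smooth_map M N F \<and>
     (\<forall>p\<in>pts M. map_rank M N F p > 0 \<and>
        pushforward M N F p ` horizontal M N F p = range (pushforward M N F p) \<and>
        (\<forall>v\<in>horizontal M N F p. \<forall>w\<in>horizontal M N F p.
           metric N (F p) (pushforward M N F p v) (pushforward M N F p w) = metric M p v w))"

definition horizontal_fields ::
  "('a, 'n::euclidean_space) riem \<Rightarrow> ('b, 'm::euclidean_space) riem \<Rightarrow> ('a \<Rightarrow> 'b) \<Rightarrow> ('a \<Rightarrow> 'n) set" where
  "horizontal_fields M N F = {X. smooth_vf M (pts M) X \<and> (\<forall>p\<in>pts M. X p \<in> horizontal M N F p)}"

text \<open>The second fundamental form \<open>(\<nabla>F\<^sub>*)(X,Y)\<close> at \<open>p\<close>; here and below \<open>D\<close> is the Levi-Civita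
  connection of \<open>M\<close> and \<open>DF\<close> the pullback of that of \<open>N\<close>.\<close>

definition second_form ::
  "('a, 'n::euclidean_space) riem \<Rightarrow> ('b, 'm::euclidean_space) riem \<Rightarrow> ('a \<Rightarrow> 'b) \<Rightarrow>
   ('a \<Rightarrow> 'n \<Rightarrow> ('a \<Rightarrow> 'n) \<Rightarrow> 'n) \<Rightarrow> ('a \<Rightarrow> 'n \<Rightarrow> ('a \<Rightarrow> 'm) \<Rightarrow> 'm) \<Rightarrow>
   ('a \<Rightarrow> 'n) \<Rightarrow> ('a \<Rightarrow> 'n) \<Rightarrow> 'a \<Rightarrow> 'm" where
  "second_form M N F D DF X Y p =
     DF p (X p) (\<lambda>q. pushforward M N F q (Y q)) - pushforward M N F p (D p (X p) Y)"

definition horizontal_frame ::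
  "('a, 'n::euclidean_space) riem \<Rightarrow> ('b, 'm::euclidean_space) riem \<Rightarrow> ('a \<Rightarrow> 'b) \<Rightarrow>
   nat \<Rightarrow> 'a set \<Rightarrow> (nat \<Rightarrow> 'a \<Rightarrow> 'n) \<Rightarrow> bool" where
  "horizontal_frame M N F r U e \<longleftrightarrow>
     (\<forall>i<r. smooth_vf M U (e i)) \<and>
     (\<forall>q\<in>U. span ((\<lambda>i. e i q) ` {..<r}) = horizontal M N F q \<and>
        (\<forall>i<r. \<forall>j<r. metric M q (e i q) (e j q) = (if i = j then 1 else 0)))"

text \<open>\<open>H\<^sub>2\<close> for a map of constant rank \<open>r\<close>; its value at \<open>p\<close> is computed from some local orthonormal
  frame of \<open>(ker F\<^sub>*)\<^sup>\<bottom>\<close> around \<open>p\<close> and does not depend on which one is selected.\<close>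

definition mean_curvature ::
  "('a, 'n::euclidean_space) riem \<Rightarrow> ('b, 'm::euclidean_space) riem \<Rightarrow> ('a \<Rightarrow> 'b) \<Rightarrow>
   ('a \<Rightarrow> 'n \<Rightarrow> ('a \<Rightarrow> 'n) \<Rightarrow> 'n) \<Rightarrow> ('a \<Rightarrow> 'n \<Rightarrow> ('a \<Rightarrow> 'm) \<Rightarrow> 'm) \<Rightarrow>
   nat \<Rightarrow> 'a \<Rightarrow> 'm" where
  "mean_curvature M N F D DF r p =
     (let e = (SOME e. \<exists>U. openin (mtop M) U \<and> p \<in> U \<and> horizontal_frame M N F r U e)
      in (1 / real r) *\<^sub>R (\<Sum>i<r. second_form M N F D DF (e i) (e i) p))"

text \<open>The orthogonal projection of \<open>w \<in> T\<^sub>F\<^sub>(\<^sub>p\<^sub>) N\<close> to \<open>range F\<^sub>*\<^sub>p\<close>.\<close>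

definition range_component ::
  "('a, 'n::euclidean_space) riem \<Rightarrow> ('b, 'm::euclidean_space) riem \<Rightarrow> ('a \<Rightarrow> 'b) \<Rightarrow> 'a \<Rightarrow> 'm \<Rightarrow> 'm" where
  "range_component M N F p w =
     (THE u. u \<in> range (pushforward M N F p) \<and>
        (\<forall>s\<in>range (pushforward M N F p). metric N (F p) (w - u) s = 0))"

text \<open>\<open>shape_operator M N F DF V X p\<close> is \<open>A\<^sub>V F\<^sub>*X\<close> at \<open>p\<close>, for \<open>V\<close> normal to \<open>range F\<^sub>*\<close> and
  \<open>X\<close> horizontal.\<close>

definition shape_operator ::
  "('a, 'n::euclidean_space) riem \<Rightarrow> ('b, 'm::euclidean_space) riem \<Rightarrow> ('a \<Rightarrow> 'b) \<Rightarrow>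
   ('a \<Rightarrow> 'n \<Rightarrow> ('a \<Rightarrow> 'm) \<Rightarrow> 'm) \<Rightarrow> ('a \<Rightarrow> 'm) \<Rightarrow> ('a \<Rightarrow> 'n) \<Rightarrow> 'a \<Rightarrow> 'm" where
  "shape_operator M N F DF V X p = - range_component M N F p (DF p (X p) V)"

definition pseudo_umbilical ::
  "('a, 'n::euclidean_space) riem \<Rightarrow> ('b, 'm::euclidean_space) riem \<Rightarrow> ('a \<Rightarrow> 'b) \<Rightarrow>
   ('a \<Rightarrow> 'n \<Rightarrow> ('a \<Rightarrow> 'n) \<Rightarrow> 'n) \<Rightarrow> ('a \<Rightarrow> 'n \<Rightarrow> ('a \<Rightarrow> 'm) \<Rightarrow> 'm) \<Rightarrow> nat \<Rightarrow> bool" where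
  "pseudo_umbilical M N F D DF r \<longleftrightarrow>
     (\<exists>l :: 'a \<Rightarrow> real. smooth_fun M (pts M) l \<and>
        (\<forall>X\<in>horizontal_fields M N F. \<forall>p\<in>pts M.
           shape_operator M N F DF (mean_curvature M N F D DF r) X p
             = l p *\<^sub>R pushforward M N F p (X p)))"

end

theory Submission
  imports Defs
begin

text \<open>Both connections are torsion free, so \<open>(\<nabla>F\<^sub>*)(X,Y)\<close> is symmetric and hence tensorial; as both
  are metric and \<open>F\<^sub>*\<close> is isometric on horizontal vectors, it is orthogonal to \<open>range F\<^sub>*\<close>.
  Therefore \<open>H\<^sub>2\<close> is a smooth normal section, and differentiating \<open>g\<^sub>2(F\<^sub>*Y, H\<^sub>2) = 0\<close> along \<open>X\<close> gives
  \<open>g\<^sub>2((\<nabla>F\<^sub>*)(X,Y), H\<^sub>2) = g\<^sub>2(A F\<^sub>*X, F\<^sub>*Y)\<close> with \<open>A\<close> the shape operator of \<open>H\<^sub>2\<close>. So \<open>A F\<^sub>*X = \<lambda> F\<^sub>*X\<close>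
  is equivalent to \<open>g\<^sub>2((\<nabla>F\<^sub>*)(X,Y), H\<^sub>2) = \<lambda> g\<^sub>1(X,Y)\<close>, and the trace over an orthonormal horizontal
  frame identifies \<open>\<lambda>\<close> as \<open>g\<^sub>2(H\<^sub>2, H\<^sub>2)\<close>.\<close>

section \<open>Calculus of smooth functions on Euclidean spaces\<close>

text \<open>Three obstacles shape the proof. The quantifiers range over global horizontal fields
  while the argument is pointwise, so each horizontal vector has to be the value of such a field;
  this is what the bump functions serve, and extending them by zero rests on the Hausdorff property.
  The horizontal spaces are given by a condition at each point, so smooth local frames have to be
  produced; constant rank ensures that a frame built near a point spans all nearby horizontal
  spaces. The pullback connection is prescribed only on sections \<open>Y \<circ> F\<close>, so its
  metric and torsion properties have to be derived, by expanding arbitrary sections in coordinate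
  fields. Moreover \<open>mean_curvature\<close> selects a frame at each point separately, so
  independence of the frame precedes any statement on the smoothness of \<open>H2\<close>; that
  smoothness allows differentiating \<open>H2\<close> and makes \<open>g2(H2, H2)\<close> an
  admissible factor.\<close>

lemma Ck_on_subset: "Ck_on k S f \<Longrightarrow> T \<subseteq> S \<Longrightarrow> Ck_on k T f"
  by (induction k arbitrary: f) (auto intro: continuous_on_subset)

lemma Ck_on_cong:
  assumes "open S" "Ck_on k S f" "\<And>x. x \<in> S \<Longrightarrow> f x = g x"
  shows "Ck_on k S g"
  using assms(2,3)
proof (induction k arbitrary: f g)
  case 0
  then show ?case by (simp cong: continuous_on_cong)
next
  case (Suc k)
  have "(g has_derivative frechet_derivative f (at x)) (at x)" if "x \<in> S" for x
    using Suc.prems that assms(1)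
    by (metis Ck_on.simps(2) frechet_derivative_works has_derivative_transform_within_open)
  then have *: "g differentiable at x" "frechet_derivative f (at x) = frechet_derivative g (at x)"
    if "x \<in> S" for x
    using that differentiableI frechet_derivative_at by blast+
  have "Ck_on k S (\<lambda>x. frechet_derivative g (at x) v)" for v
    by (rule Suc.IH[of "\<lambda>x. frechet_derivative f (at x) v"]) (use Suc.prems(1) * in auto)
  with * show ?case by simp
qed

text \<open>Derivatives are unique on open sets, so any closed formula for the derivative may
  replace \<open>frechet_derivative\<close>. The inductions on the order below all go through this
  form.\<close>

lemma Ck_on_has_derivI:
  assumes "open S" "\<And>x. x \<in> S \<Longrightarrow> (f has_derivative f' x) (at x)"
    and "\<And>v. Ck_on k S (\<lambda>x. f' x v)"
  shows "Ck_on (Suc k) S f"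
proof -
  have *: "f differentiable at x" "f' x = frechet_derivative f (at x)" if "x \<in> S" for x
    using that assms(2) differentiableI frechet_derivative_at by blast+
  have "Ck_on k S (\<lambda>x. frechet_derivative f (at x) v)" for v
    by (rule Ck_on_cong[OF assms(1,3)]) (simp add: *)
  with * show ?thesis by simp
qed

lemma Ck_on_SucD: "Ck_on (Suc k) S f \<Longrightarrow> Ck_on k S f"
proof (induction k arbitrary: f)
  case 0
  then show ?case
    by (auto intro!: continuous_at_imp_continuous_on differentiable_imp_continuous_within)
next
  case (Suc k)
  have "Ck_on k S (\<lambda>x. frechet_derivative f (at x) v)" for v
    by (rule Suc.IH) (use Ck_on.simps(2)[of "Suc k" S f] Suc.prems in blast)
  with Suc.prems show ?case by simp
qed

lemma Ck_on_local:
  assumes "\<And>x. x \<in> S \<Longrightarrow> \<exists>T. open T \<and> x \<in> T \<and> Ck_on k T f"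
  shows "Ck_on k S f"
  using assms
proof (induction k arbitrary: f)
  case 0
  then have "isCont f x" if "x \<in> S" for x
    using that continuous_on_eq_continuous_at by (metis Ck_on.simps(1))
  then show ?case by (simp add: continuous_at_imp_continuous_on)
next
  case (Suc k)
  have "Ck_on k S (\<lambda>x. frechet_derivative f (at x) v)" for v
  proof (rule Suc.IH)
    show "\<exists>T. open T \<and> x \<in> T \<and> Ck_on k T (\<lambda>x. frechet_derivative f (at x) v)" if "x \<in> S" for x
      using Suc.prems[OF that] by auto
  qed
  moreover have "f differentiable at x" if "x \<in> S" for x
    using Suc.prems[OF that] by auto
  ultimately show ?case by simp
qed

lemma Ck_on_const: "open S \<Longrightarrow> Ck_on k S (\<lambda>x. c)"
  by (induction k arbitrary: c) (auto intro!: Ck_on_has_derivI[where f' = "\<lambda>_ _. 0"])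

lemma Ck_on_has_deriv:
  "Ck_on (Suc k) S f \<Longrightarrow> x \<in> S \<Longrightarrow> (f has_derivative frechet_derivative f (at x)) (at x)"
  by (simp flip: frechet_derivative_works)

lemma Ck_on_add:
  assumes "open S"
  shows "Ck_on k S f \<Longrightarrow> Ck_on k S g \<Longrightarrow> Ck_on k S (\<lambda>x. f x + g x)"
proof (induction k arbitrary: f g)
  case (Suc k)
  show ?case
    by (rule Ck_on_has_derivI[OF assms
          has_derivative_add[OF Suc.prems[THEN Ck_on_has_deriv]]])
      (use Suc in auto)
qed (auto intro: continuous_on_add)

lemma Ck_on_bounded_linear:
  assumes "open S" "bounded_linear L"
  shows "Ck_on k S f \<Longrightarrow> Ck_on k S (\<lambda>x. L (f x))"
proof (induction k arbitrary: f)
  case 0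
  then show ?case using assms by (auto intro: bounded_linear.continuous_on)
next
  case (Suc k)
  show ?case
    by (rule Ck_on_has_derivI[OF assms(1)
          bounded_linear.has_derivative[OF assms(2) Suc.prems[THEN Ck_on_has_deriv]]])
      (use Suc in auto)
qed

lemma Ck_on_bounded_bilinear:
  assumes "open S" "bounded_bilinear pr"
  shows "Ck_on k S f \<Longrightarrow> Ck_on k S g \<Longrightarrow> Ck_on k S (\<lambda>x. pr (f x) (g x))"
proof (induction k arbitrary: f g)
  case 0
  then show ?case using assms by (auto intro: bounded_bilinear.continuous_on)
next
  case (Suc k)
  show ?case
  proof (rule Ck_on_has_derivI[OF assms(1)])
    show "((\<lambda>x. pr (f x) (g x)) has_derivative (\<lambda>h. pr (f x) (frechet_derivative g (at x) h)
       + pr (frechet_derivative f (at x) h) (g x))) (at x)" if "x \<in> S" for x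
      by (intro bounded_bilinear.FDERIV[OF assms(2)] Suc.prems[THEN Ck_on_has_deriv] that)
    show "Ck_on k S (\<lambda>x. pr (f x) (frechet_derivative g (at x) v)
       + pr (frechet_derivative f (at x) v) (g x))" for v
      using Suc Ck_on_SucD[OF Suc.prems(1)] Ck_on_SucD[OF Suc.prems(2)]
      by (intro Ck_on_add[OF assms(1)] Suc.IH) auto
  qed
qed

lemma Ck_on_sum:
  assumes "open S" "\<And>i. i \<in> I \<Longrightarrow> Ck_on k S (f i)"
  shows "Ck_on k S (\<lambda>x. \<Sum>i\<in>I. f i x)"
  using assms(2)
  by (induction I rule: infinite_finite_induct) (auto intro: Ck_on_const Ck_on_add assms(1))

lemma linear_sum_Basis:
  fixes L :: "'n::euclidean_space \<Rightarrow> 'e::real_vector"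
  assumes "linear L"
  shows "L v = (\<Sum>b\<in>Basis. (v \<bullet> b) *\<^sub>R L b)"
  by (metis (no_types, lifting) assms euclidean_representation linear_sum linear_cmul sum.cong)

text \<open>The derivative of the composite differentiates \<open>f\<close> in a direction that
  moves with \<open>x\<close>, while \<open>Ck_on\<close> controls fixed directions. Expanding in
  \<open>Basis\<close> gives a finite sum of products of fixed directional derivatives, to which the
  induction hypothesis applies with the same \<open>g\<close>.\<close>

lemma Ck_on_compose:
  fixes g :: "'n::euclidean_space \<Rightarrow> 'm::euclidean_space"
  assumes "open S" "open T" "g ` S \<subseteq> T"
  shows "Ck_on k T f \<Longrightarrow> Ck_on k S g \<Longrightarrow> Ck_on k S (\<lambda>x. f (g x))"
proof (induction k arbitrary: f)
  case 0
  then show ?case using assms by (auto intro: continuous_on_compose2)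
next
  case (Suc k)
  let ?f' = "\<lambda>x. frechet_derivative f (at x)" and ?g' = "\<lambda>x. frechet_derivative g (at x)"
  have der: "((\<lambda>x. f (g x)) has_derivative (\<lambda>v. ?f' (g x) (?g' x v))) (at x)" if "x \<in> S" for x
    using that assms(3)
    by (auto intro!: has_derivative_compose[OF Suc.prems(2)[THEN Ck_on_has_deriv]
          Suc.prems(1)[THEN Ck_on_has_deriv]] simp del: Ck_on.simps)
  have eq: "?f' (g x) (?g' x v) = (\<Sum>b\<in>Basis. (?g' x v \<bullet> b) *\<^sub>R ?f' (g x) b)" if "x \<in> S" for x v
    using has_derivative_linear[OF Ck_on_has_deriv[OF Suc.prems(1)]] that assms(3)
    by (intro linear_sum_Basis[where L = "?f' (g x)"]) auto
  have "Ck_on k S (\<lambda>x. \<Sum>b\<in>Basis. (?g' x v \<bullet> b) *\<^sub>R ?f' (g x) b)" for v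
    using Suc Ck_on_SucD[OF Suc.prems(2)]
    by (intro Ck_on_sum assms Ck_on_bounded_bilinear[OF _ bounded_bilinear_scaleR]
        Ck_on_bounded_linear[OF _ bounded_linear_inner_left]) auto
  then have "Ck_on k S (\<lambda>x. ?f' (g x) (?g' x v))" for v
    by (rule Ck_on_cong[OF assms(1)]) (simp add: eq)
  with der show ?case
    by (rule Ck_on_has_derivI[OF assms(1)])
qed

lemma smooth_on_subset: "smooth_on S f \<Longrightarrow> T \<subseteq> S \<Longrightarrow> smooth_on T f"
  by (auto simp: smooth_on_def intro: Ck_on_subset)

lemma smooth_on_cong:
  "open S \<Longrightarrow> smooth_on S f \<Longrightarrow> (\<And>x. x \<in> S \<Longrightarrow> f x = g x) \<Longrightarrow> smooth_on S g"
  by (auto simp: smooth_on_def intro: Ck_on_cong)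

lemma smooth_on_local:
  "(\<And>x. x \<in> S \<Longrightarrow> \<exists>T. open T \<and> x \<in> T \<and> smooth_on T f) \<Longrightarrow> smooth_on S f"
  unfolding smooth_on_def by (intro allI Ck_on_local) meson

lemma smooth_on_const: "open S \<Longrightarrow> smooth_on S (\<lambda>x. c)"
  by (auto simp: smooth_on_def intro: Ck_on_const)

lemma smooth_on_ident: "open S \<Longrightarrow> smooth_on S (\<lambda>x. x)"
  unfolding smooth_on_def
proof
  show "Ck_on k S (\<lambda>x. x)" if "open S" for k
    by (cases k) (auto intro!: that Ck_on_has_derivI[where f' = "\<lambda>_ v. v"] Ck_on_const)
qed

lemma smooth_on_add:
  "open S \<Longrightarrow> smooth_on S f \<Longrightarrow> smooth_on S g \<Longrightarrow> smooth_on S (\<lambda>x. f x + g x)"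
  by (auto simp: smooth_on_def intro: Ck_on_add)

lemma smooth_on_bounded_linear:
  "open S \<Longrightarrow> bounded_linear L \<Longrightarrow> smooth_on S f \<Longrightarrow> smooth_on S (\<lambda>x. L (f x))"
  by (auto simp: smooth_on_def intro: Ck_on_bounded_linear)

lemma smooth_on_scaleR:
  "open S \<Longrightarrow> smooth_on S f \<Longrightarrow> smooth_on S g \<Longrightarrow> smooth_on S (\<lambda>x. f x *\<^sub>R g x)"
  by (auto simp: smooth_on_def intro: Ck_on_bounded_bilinear bounded_bilinear_scaleR)

lemma smooth_on_inner:
  "open S \<Longrightarrow> smooth_on S f \<Longrightarrow> smooth_on S g \<Longrightarrow> smooth_on S (\<lambda>x. f x \<bullet> g x)"
  by (auto simp: smooth_on_def intro: Ck_on_bounded_bilinear bounded_bilinear_inner)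

lemma smooth_on_sum:
  "open S \<Longrightarrow> (\<And>i. i \<in> I \<Longrightarrow> smooth_on S (f i)) \<Longrightarrow> smooth_on S (\<lambda>x. \<Sum>i\<in>I. f i x)"
  by (auto simp: smooth_on_def intro: Ck_on_sum)

lemma smooth_on_compose:
  fixes g :: "'n::euclidean_space \<Rightarrow> 'm::euclidean_space"
  assumes "open S" "open T" "g ` S \<subseteq> T" "smooth_on T f" "smooth_on S g"
  shows "smooth_on S (\<lambda>x. f (g x))"
  using assms(4,5) Ck_on_compose[OF assms(1-3), where f = f] unfolding smooth_on_def by blast

lemma smooth_on_has_derivative:
  assumes "smooth_on S f" "x \<in> S"
  shows "(f has_derivative frechet_derivative f (at x)) (at x)"
  using assms Ck_on_has_deriv[of 0 S f x] unfolding smooth_on_def by blast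

lemma smooth_on_frechet_derivative:
  "smooth_on S f \<Longrightarrow> smooth_on S (\<lambda>x. frechet_derivative f (at x) v)"
  unfolding smooth_on_def using Ck_on.simps(2)[of _ S f] by blast

lemma smooth_on_directional:
  assumes "open S" "smooth_on S f" "smooth_on S V"
  shows "smooth_on S (\<lambda>x. frechet_derivative f (at x) (V x))"
proof (rule smooth_on_cong[OF assms(1)])
  show "smooth_on S (\<lambda>x. \<Sum>b\<in>Basis. (V x \<bullet> b) *\<^sub>R frechet_derivative f (at x) b)"
    by (intro smooth_on_sum smooth_on_scaleR smooth_on_bounded_linear[OF _ bounded_linear_inner_left]
        smooth_on_frechet_derivative assms)
  show "(\<Sum>b\<in>Basis. (V x \<bullet> b) *\<^sub>R frechet_derivative f (at x) b) = frechet_derivative f (at x) (V x)"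
    if "x \<in> S" for x
    using smooth_on_has_derivative[OF assms(2) that]
    by (metis linear_sum_Basis has_derivative_linear)
qed

text \<open>All exponents are treated at once, since differentiation lowers the exponent by one. The
  value -1/2 normalises vector fields in \<open>gram_schmidt\<close>.\<close>

lemma smooth_on_powr: "smooth_on {0<..} (\<lambda>x::real. x powr a)"
  unfolding smooth_on_def
proof
  show "Ck_on k {0<..} (\<lambda>x::real. x powr a)" for k
  proof (induction k arbitrary: a)
    case 0
    then show ?case by (auto intro!: continuous_intros)
  next
    case (Suc k)
    have "((\<lambda>x. x powr a) has_derivative (\<lambda>v. (v * a) *\<^sub>R x powr (a - 1))) (at x)"
      if "x \<in> {0<..}" for x :: real
    proof (rule has_derivative_eq_rhs)
      show "((\<lambda>x. x powr a) has_derivative (*) (a * x powr (a - 1))) (at x)"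
        using has_real_derivative_powr[of x a] that by (simp add: has_field_derivative_def)
    qed (simp add: fun_eq_iff)
    then show ?case
      by (rule Ck_on_has_derivI[OF open_greaterThan])
        (assumption | intro open_greaterThan Suc Ck_on_bounded_linear[OF _ bounded_linear_scaleR_right])+
  qed
qed

section \<open>Smooth bump functions on Euclidean spaces\<close>

definition flat :: "nat \<Rightarrow> real \<Rightarrow> real" where
  "flat n x = (if x \<le> 0 then 0 else inverse x ^ n * exp (- inverse x))"

lemma flat_tendsto_0: "((\<lambda>x. inverse x ^ n * exp (- inverse x)) \<longlongrightarrow> 0) (at_right (0::real))"
proof -
  have "((\<lambda>y::real. y ^ n * exp (- y)) \<longlongrightarrow> 0) at_top"
    using tendsto_power_div_exp_0[of n] by (simp add: exp_minus field_simps)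
  from filterlim_compose[OF this filterlim_inverse_at_top_right] show ?thesis .
qed

lemma flat_has_derivative:
  "(flat n has_real_derivative flat (n + 2) x - real n * flat (Suc n) x) (at x)"
proof -
  consider "x < 0" | "x > 0" | "x = 0" by linarith
  then show ?thesis
  proof cases
    case 1
    then have "((\<lambda>_. 0) has_real_derivative flat (n + 2) x - real n * flat (Suc n) x) (at x)"
      by (simp add: flat_def)
    then show ?thesis
      by (rule has_field_derivative_transform_within_open[where S = "{..<0}"])
        (use 1 in \<open>auto simp: flat_def\<close>)
  next
    case 2
    have "((\<lambda>x. inverse x ^ n * exp (- inverse x)) has_real_derivative
       (real n * inverse x ^ (n - 1) * (- (inverse x ^ 2))) * exp (- inverse x)
       + inverse x ^ n * (exp (- inverse x) * inverse x ^ 2)) (at x)"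
      using 2 by (auto intro!: derivative_eq_intros simp: power2_eq_square)
    then have "((\<lambda>x. inverse x ^ n * exp (- inverse x)) has_real_derivative
       flat (n + 2) x - real n * flat (Suc n) x) (at x)"
      \<comment> \<open>The exponent \<open>n - 1\<close> is a truncated difference, hence the case
        split; for \<open>n = 0\<close> the factor \<open>real n\<close> removes the term.\<close>
      by (rule DERIV_cong)
        (use 2 in \<open>cases n; simp add: flat_def algebra_simps power2_eq_square\<close>)
    then show ?thesis
      by (rule has_field_derivative_transform_within_open[where S = "{0<..}"])
        (use 2 in \<open>auto simp: flat_def\<close>)
  next
    case 3
    \<comment> \<open>To the right of 0 the difference quotient of \<open>flat n\<close> is the
      expression of \<open>flat (Suc n)\<close>, which tends to 0; to the left it vanishes.\<close>
    have "((\<lambda>y. (flat n y - flat n 0) / (y - 0)) \<longlongrightarrow> 0) (at_right 0)"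
      by (rule Lim_transform_eventually[OF flat_tendsto_0[of "Suc n"]])
        (auto simp: flat_def eventually_at_right_field field_simps intro!: exI[of _ 1])
    moreover have "((\<lambda>y. (flat n y - flat n 0) / (y - 0)) \<longlongrightarrow> 0) (at_left 0)"
      by (rule Lim_transform_eventually[OF tendsto_const])
        (auto simp: flat_def eventually_at_left_field intro!: exI[of _ "-1"])
    ultimately show ?thesis
      unfolding 3 has_field_derivative_iff by (simp add: filterlim_split_at flat_def)
  qed
qed

lemma smooth_on_flat: "smooth_on UNIV (flat n)"
  unfolding smooth_on_def
proof
  show "Ck_on k UNIV (flat n)" for k
  proof (induction k arbitrary: n)
    case 0
    then show ?case
      by (auto intro!: continuous_at_imp_continuous_on DERIV_isCont flat_has_derivative)
  next
    case (Suc k)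
    have "(flat n has_derivative
        (\<lambda>v. v *\<^sub>R flat (n + 2) x + (- real n * v) *\<^sub>R flat (Suc n) x)) (at x)" for x
      using flat_has_derivative[of n x] unfolding has_field_derivative_def
      by (rule has_derivative_eq_rhs) (simp add: fun_eq_iff algebra_simps)
    then show ?case
      by (rule Ck_on_has_derivI[OF open_UNIV])
        (assumption | intro open_UNIV Suc Ck_on_add Ck_on_bounded_linear[OF _ bounded_linear_scaleR_right])+
  qed
qed

text \<open>\<open>flat 0\<close> is positive exactly on positive arguments, so inserting
  \<open>r^2 - |y - x|^2\<close> yields a function supported in the ball. The square keeps it smooth
  at the centre, and dividing by the value there normalises it.\<close>

lemma smooth_bump:
  fixes x :: "'n::euclidean_space"
  assumes "0 < r"
  obtains \<psi> :: "'n \<Rightarrow> real"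
    where "smooth_on UNIV \<psi>" "\<psi> x = 1" "\<And>y. y \<notin> cball x r \<Longrightarrow> \<psi> y = 0"
proof
  let ?f = "\<lambda>y. flat 0 (r\<^sup>2 + (- 1) *\<^sub>R ((y - x) \<bullet> (y - x)))"
  let ?c = "flat 0 (r\<^sup>2)"
  show "smooth_on UNIV (\<lambda>y. (1 / ?c) *\<^sub>R ?f y)"
    by (intro smooth_on_scaleR smooth_on_const smooth_on_compose[OF _ _ _ smooth_on_flat]
        smooth_on_add smooth_on_inner
        smooth_on_add[where g = "\<lambda>_. - x", simplified] smooth_on_ident) auto
  show "(1 / ?c) *\<^sub>R ?f x = 1"
    using assms by (simp add: flat_def)
  show "(1 / ?c) *\<^sub>R ?f y = 0" if "y \<notin> cball x r" for y
  proof -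
    have "r\<^sup>2 \<le> (norm (y - x))\<^sup>2"
      using that assms by (intro power_mono) (auto simp: dist_norm norm_minus_commute)
    then show ?thesis by (simp add: flat_def dot_square_norm)
  qed
qed

section \<open>Calculus on manifolds\<close>

lemma chart_at:
  assumes "smooth_manifold M" "p \<in> pts M"
  shows "chart_at M p \<in> atlas M" "p \<in> fst (chart_at M p)"
proof -
  have "p \<in> \<Union> (fst ` atlas M)"
    using assms by (simp add: smooth_manifold_def)
  then have "\<exists>c. c \<in> atlas M \<and> p \<in> fst c" by blast
  from someI_ex[OF this] show "chart_at M p \<in> atlas M" "p \<in> fst (chart_at M p)"
    unfolding chart_at_def by auto
qed

lemma chart_domain:
  assumes "smooth_manifold M" "c \<in> atlas M"
  shows "openin (mtop M) (fst c)" "fst c \<subseteq> pts M"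
  using assms openin_subset unfolding smooth_manifold_def is_chart_def by auto

lemma chart_inj:
  assumes "smooth_manifold M" "c \<in> atlas M"
  shows "inj_on (snd c) (fst c)"
proof -
  have "homeomorphic_map (subtopology (mtop M) (fst c)) (top_of_set (snd c ` fst c)) (snd c)"
    using assms unfolding smooth_manifold_def is_chart_def by auto
  moreover have "topspace (subtopology (mtop M) (fst c)) = fst c"
    using chart_domain[OF assms] by (simp add: Int_absorb1)
  ultimately show ?thesis
    using homeomorphic_imp_injective_map by metis
qed

lemma chart_inv [simp]:
  assumes "smooth_manifold M" "c \<in> atlas M" "q \<in> fst c"
  shows "chart_inv c (snd c q) = q"
  using chart_inj[OF assms(1,2)] assms(3) by simp

text \<open>A chart is a homeomorphism onto an open Euclidean set, so relatively open subsets of its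
  image are open. Smoothness on a manifold is tested on these images.\<close>

lemma chart_image_open:
  assumes "smooth_manifold M" "c \<in> atlas M" "openin (mtop M) W"
  shows "open (snd c ` (fst c \<inter> W))"
proof -
  have "homeomorphic_map (subtopology (mtop M) (fst c)) (top_of_set (snd c ` fst c)) (snd c)"
    and op: "open (snd c ` fst c)"
    using assms unfolding smooth_manifold_def is_chart_def by auto
  then have "openin (top_of_set (snd c ` fst c)) (snd c ` (fst c \<inter> W))"
    using homeomorphic_imp_open_map assms(3) unfolding open_map_def
    by (metis inf_commute openin_subtopology_Int)
  then show ?thesis
    using op openin_open_eq by blast
qed

lemma chart_preimage_open:
  assumes "smooth_manifold M" "c \<in> atlas M" "open B"
  shows "openin (mtop M) (fst c \<inter> snd c -` B)"
proof -
  have "homeomorphic_map (subtopology (mtop M) (fst c)) (top_of_set (snd c ` fst c)) (snd c)"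
    using assms unfolding smooth_manifold_def is_chart_def by auto
  then have "continuous_map (subtopology (mtop M) (fst c)) euclidean (snd c)"
    using homeomorphic_imp_continuous_map continuous_map_into_fulltopology by metis
  then have "openin (subtopology (mtop M) (fst c))
      {x \<in> topspace (subtopology (mtop M) (fst c)). snd c x \<in> B}"
    by (rule openin_continuous_map_preimage) (simp add: assms(3))
  moreover have "{x \<in> topspace (subtopology (mtop M) (fst c)). snd c x \<in> B} = fst c \<inter> snd c -` B"
    using chart_domain[OF assms(1,2)] by auto
  ultimately show ?thesis
    using chart_domain[OF assms(1,2)] openin_trans_full by metis
qed

lemma smooth_fun_subset: "smooth_fun M W f \<Longrightarrow> U \<subseteq> W \<Longrightarrow> smooth_fun M U f"
  unfolding smooth_fun_def by (blast intro: smooth_on_subset)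

lemma smooth_fun_chart:
  assumes "smooth_manifold M" "c \<in> atlas M"
  shows "smooth_fun M (fst c) (snd c)"
  using assms unfolding smooth_fun_def smooth_manifold_def by auto

lemma smooth_fun_cong:
  assumes "smooth_manifold M" "openin (mtop M) W" "smooth_fun M W f" "\<And>q. q \<in> W \<Longrightarrow> f q = g q"
  shows "smooth_fun M W g"
  unfolding smooth_fun_def
proof
  fix c assume c: "c \<in> atlas M"
  show "smooth_on (snd c ` (fst c \<inter> W)) (g \<circ> chart_inv c)"
    by (rule smooth_on_cong[OF chart_image_open[OF assms(1) c assms(2)], of "f \<circ> chart_inv c"])
      (use assms c in \<open>auto simp: smooth_fun_def\<close>)
qed

lemma smooth_fun_local:
  assumes "smooth_manifold M"
    and loc: "\<And>q. q \<in> W \<Longrightarrow> \<exists>U. openin (mtop M) U \<and> q \<in> U \<and> smooth_fun M U f"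
  shows "smooth_fun M W f"
  unfolding smooth_fun_def
proof (intro ballI smooth_on_local)
  fix c x assume c: "c \<in> atlas M" and "x \<in> snd c ` (fst c \<inter> W)"
  then obtain q where q: "q \<in> fst c" "q \<in> W" "x = snd c q" by auto
  with loc obtain U where "openin (mtop M) U" "q \<in> U" "smooth_fun M U f" by blast
  with q c show "\<exists>T. open T \<and> x \<in> T \<and> smooth_on T (f \<circ> chart_inv c)"
    by (intro exI[of _ "snd c ` (fst c \<inter> U)"])
      (auto simp: smooth_fun_def chart_image_open[OF assms(1)])
qed

lemma smooth_fun_compose_smooth_on:
  fixes f :: "'a \<Rightarrow> 'm::euclidean_space"
  assumes "smooth_manifold M" "openin (mtop M) W" "smooth_fun M W f" "open T" "f ` W \<subseteq> T"
    "smooth_on T h"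
  shows "smooth_fun M W (\<lambda>q. h (f q))"
  unfolding smooth_fun_def
proof
  fix c assume c: "c \<in> atlas M"
  have "(f \<circ> chart_inv c) ` snd c ` (fst c \<inter> W) \<subseteq> T"
    using assms(1,5) c by auto
  then have "smooth_on (snd c ` (fst c \<inter> W)) (\<lambda>x. h ((f \<circ> chart_inv c) x))"
    using assms c chart_image_open[OF assms(1) c assms(2)] unfolding smooth_fun_def
    by (intro smooth_on_compose[where T = T and f = h and g = "f \<circ> chart_inv c"]) auto
  then show "smooth_on (snd c ` (fst c \<inter> W)) ((\<lambda>q. h (f q)) \<circ> chart_inv c)"
    by (simp add: o_def)
qed

lemma smooth_fun_const: "smooth_manifold M \<Longrightarrow> openin (mtop M) W \<Longrightarrow> smooth_fun M W (\<lambda>q. a)"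
  unfolding smooth_fun_def o_def by (auto intro!: smooth_on_const chart_image_open)

lemma smooth_fun_add:
  "smooth_manifold M \<Longrightarrow> openin (mtop M) W \<Longrightarrow> smooth_fun M W f \<Longrightarrow> smooth_fun M W g \<Longrightarrow>
   smooth_fun M W (\<lambda>q. f q + g q)"
  unfolding smooth_fun_def o_def by (auto intro!: smooth_on_add chart_image_open)

lemma smooth_fun_scaleR:
  "smooth_manifold M \<Longrightarrow> openin (mtop M) W \<Longrightarrow> smooth_fun M W f \<Longrightarrow> smooth_fun M W g \<Longrightarrow>
   smooth_fun M W (\<lambda>q. f q *\<^sub>R g q)"
  unfolding smooth_fun_def o_def by (auto intro!: smooth_on_scaleR chart_image_open)

lemma smooth_fun_bounded_linear:
  "smooth_manifold M \<Longrightarrow> openin (mtop M) W \<Longrightarrow> bounded_linear L \<Longrightarrow> smooth_fun M W f \<Longrightarrow>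
   smooth_fun M W (\<lambda>q. L (f q))"
  unfolding smooth_fun_def o_def
  by (intro ballI, rule smooth_on_bounded_linear) (auto intro: chart_image_open)

lemma smooth_fun_sum:
  "smooth_manifold M \<Longrightarrow> openin (mtop M) W \<Longrightarrow> (\<And>i. i \<in> I \<Longrightarrow> smooth_fun M W (f i)) \<Longrightarrow>
   smooth_fun M W (\<lambda>q. \<Sum>i\<in>I. f i q)"
  unfolding smooth_fun_def o_def by (auto intro!: smooth_on_sum chart_image_open)

lemma smooth_fun_has_derivative:
  assumes "smooth_fun M W f" "p \<in> W" "c \<in> atlas M" "p \<in> fst c"
  shows "(f \<circ> chart_inv c has_derivative frechet_derivative (f \<circ> chart_inv c) (at (snd c p)))
    (at (snd c p))"
  using assms unfolding smooth_fun_def by (intro smooth_on_has_derivative) auto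

lemma smooth_map_fun:
  assumes "smooth_map M N F" "d \<in> atlas N"
  shows "smooth_fun M (pts M \<inter> F -` fst d) (snd d \<circ> F)"
  using assms unfolding smooth_map_def by auto

lemma smooth_map_open:
  assumes "smooth_map M N F" "openin (mtop N) W" "openin (mtop M) U"
  shows "openin (mtop M) (U \<inter> F -` W)"
proof -
  have "openin (mtop M) {x \<in> pts M. F x \<in> W}"
    using assms(1,2) openin_continuous_map_preimage unfolding smooth_map_def by blast
  moreover have "U \<inter> F -` W = U \<inter> {x \<in> pts M. F x \<in> W}"
    using openin_subset[OF assms(3)] by auto
  ultimately show ?thesis
    using assms(3) openin_Int by metis
qed

lemma smooth_map_ident: "smooth_manifold M \<Longrightarrow> smooth_map M M (\<lambda>q. q)"
  unfolding smooth_map_def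
  by (auto simp: o_def intro: smooth_fun_subset[OF smooth_fun_chart])

lemma smooth_map_in_pts: "smooth_map M N F \<Longrightarrow> p \<in> pts M \<Longrightarrow> F p \<in> pts N"
  unfolding smooth_map_def continuous_map_def by auto

text \<open>The chain rule is stated for any chart \<open>c\<close> around \<open>p\<close> and any
  chart \<open>d\<close> around \<open>F p\<close>. This freedom matters: with the identity for
  \<open>F\<close> it is the change of charts, from which the rules for coordinate fields
  follow.\<close>

lemma has_derivative_chart_compose:
  assumes "smooth_manifold M" "smooth_manifold N" "smooth_map M N F"
    and "openin (mtop N) W" "smooth_fun N W f" "p \<in> pts M" "F p \<in> W"
    and "c \<in> atlas M" "p \<in> fst c" "d \<in> atlas N" "F p \<in> fst d"
  shows "((f \<circ> F) \<circ> chart_inv c has_derivative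
    (\<lambda>v. frechet_derivative (f \<circ> chart_inv d) (at (snd d (F p)))
      (frechet_derivative ((snd d \<circ> F) \<circ> chart_inv c) (at (snd c p)) v))) (at (snd c p))"
proof (rule has_derivative_transform_within_open)
  let ?h = "(snd d \<circ> F) \<circ> chart_inv c"
  let ?U = "pts M \<inter> F -` fst d"
  show "((\<lambda>x. (f \<circ> chart_inv d) (?h x)) has_derivative
     (\<lambda>v. frechet_derivative (f \<circ> chart_inv d) (at (snd d (F p)))
      (frechet_derivative ?h (at (snd c p)) v))) (at (snd c p))"
  proof (rule has_derivative_compose[where f = ?h and g = "f \<circ> chart_inv d"])
    show "(?h has_derivative frechet_derivative ?h (at (snd c p))) (at (snd c p))"
      using assms smooth_map_fun[OF assms(3,10)] by (intro smooth_fun_has_derivative[of _ ?U]) auto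
    show "(f \<circ> chart_inv d has_derivative frechet_derivative (f \<circ> chart_inv d) (at (snd d (F p))))
        (at (?h (snd c p)))"
      using assms smooth_fun_has_derivative[of N W f "F p" d] by simp
  qed
  show "open (snd c ` (fst c \<inter> ?U))"
    by (rule chart_image_open[OF assms(1,8)
          smooth_map_open[OF assms(3) chart_domain(1)[OF assms(2,10)] openin_topspace]])
  show "snd c p \<in> snd c ` (fst c \<inter> ?U)"
    using assms by auto
  show "(f \<circ> chart_inv d) (?h x) = (f \<circ> F \<circ> chart_inv c) x" if "x \<in> snd c ` (fst c \<inter> ?U)" for x
    using that assms by auto
qed

lemma differential_compose_chart:
  assumes "smooth_manifold M" "smooth_manifold N" "smooth_map M N F"
    and "openin (mtop N) W" "smooth_fun N W f" "p \<in> pts M" "F p \<in> W" "d \<in> atlas N" "F p \<in> fst d"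
  shows "differential M (f \<circ> F) p v =
    frechet_derivative (f \<circ> chart_inv d) (at (snd d (F p))) (differential M (snd d \<circ> F) p v)"
  using has_derivative_chart_compose[OF assms(1-7) chart_at[OF assms(1,6)] assms(8,9)]
  unfolding differential_def by (metis frechet_derivative_at)

lemma differential_compose:
  assumes "smooth_manifold M" "smooth_manifold N" "smooth_map M N F"
    and "openin (mtop N) W" "smooth_fun N W f" "p \<in> pts M" "F p \<in> W"
  shows "differential M (\<lambda>q. f (F q)) p v = differential N f (F p) (pushforward M N F p v)"
  using differential_compose_chart[OF assms chart_at[OF assms(2) smooth_map_in_pts[OF assms(3,6)]]]
  unfolding pushforward_def by (simp add: differential_def o_def)

text \<open>\<open>differential\<close> is computed in the chart selected at \<open>p\<close>, which
  may jump with \<open>p\<close>. Here it is rewritten in a fixed chart, the form in which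
  smoothness in \<open>p\<close> can be proved.\<close>

lemma differential_chart:
  assumes "smooth_manifold M" "openin (mtop M) W" "smooth_fun M W f" "p \<in> W"
    "c \<in> atlas M" "p \<in> fst c"
  shows "differential M f p v =
    frechet_derivative (f \<circ> chart_inv c) (at (snd c p)) (differential M (snd c) p v)"
proof -
  have "p \<in> pts M" using assms(2,4) openin_subset by blast
  from differential_compose_chart[OF assms(1,1) smooth_map_ident[OF assms(1)] assms(2,3) this assms(4-6)]
  show ?thesis by (simp add: o_def)
qed

lemma smooth_fun_compose:
  assumes "smooth_manifold M" "smooth_manifold N" "smooth_map M N F"
    and "openin (mtop N) W" "smooth_fun N W f"
  shows "smooth_fun M (pts M \<inter> F -` W) (\<lambda>q. f (F q))"
proof (rule smooth_fun_local[OF assms(1)])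
  fix p assume p: "p \<in> pts M \<inter> F -` W"
  define d where "d = chart_at N (F p)"
  have d: "d \<in> atlas N" "F p \<in> fst d"
    using chart_at[OF assms(2) smooth_map_in_pts[OF assms(3)]] p unfolding d_def by auto
  let ?U = "pts M \<inter> F -` (fst d \<inter> W)"
  have op: "openin (mtop M) ?U"
    by (rule smooth_map_open[OF assms(3) openin_Int[OF chart_domain(1)[OF assms(2) d(1)] assms(4)]
          openin_topspace])
  have "smooth_fun M ?U (\<lambda>q. (f \<circ> chart_inv d) ((snd d \<circ> F) q))"
  proof (rule smooth_fun_compose_smooth_on[OF assms(1) op])
    show "smooth_fun M ?U (snd d \<circ> F)"
      by (rule smooth_fun_subset[OF smooth_map_fun[OF assms(3) d(1)]]) auto
    show "smooth_on (snd d ` (fst d \<inter> W)) (f \<circ> chart_inv d)"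
      using assms(5) d unfolding smooth_fun_def by auto
    show "open (snd d ` (fst d \<inter> W))"
      using chart_image_open assms(2,4) d by blast
  qed auto
  then have "smooth_fun M ?U (\<lambda>q. f (F q))"
    by (rule smooth_fun_cong[OF assms(1) op]) (use assms d in auto)
  with op p d show "\<exists>U. openin (mtop M) U \<and> p \<in> U \<and> smooth_fun M U (\<lambda>q. f (F q))"
    by (intro exI[of _ ?U]) auto
qed

lemma smooth_fun_in_chart:
  assumes "smooth_manifold M" "c \<in> atlas M" "openin (mtop M) W" "W \<subseteq> fst c"
    and "smooth_on (snd c ` W) h"
  shows "smooth_fun M W (\<lambda>q. h (snd c q))"
proof (rule smooth_fun_compose_smooth_on[OF assms(1,3) _ _ _ assms(5)])
  show "smooth_fun M W (snd c)"
    by (rule smooth_fun_subset[OF smooth_fun_chart[OF assms(1,2)] assms(4)])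
  show "open (snd c ` W)"
    using chart_image_open[OF assms(1-3)] assms(4) by (simp add: Int_absorb1)
qed auto

section \<open>Rules for the differential at a point\<close>

context
  fixes M :: "('a, 'n::euclidean_space) riem" and W :: "'a set" and p :: 'a
  assumes M: "smooth_manifold M" and W: "openin (mtop M) W" "p \<in> W"
begin

lemma differential_point: "p \<in> pts M"
  using W openin_subset by blast

lemma differential_has_derivative:
  "smooth_fun M W f \<Longrightarrow>
   (f \<circ> chart_inv (chart_at M p) has_derivative differential M f p) (at (snd (chart_at M p) p))"
  unfolding differential_def[abs_def]
  by (rule smooth_fun_has_derivative[OF _ W(2) chart_at[OF M differential_point]])

lemma differential_eqI:
  "(f \<circ> chart_inv (chart_at M p) has_derivative f') (at (snd (chart_at M p) p)) \<Longrightarrow>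
   differential M f p v = f' v"
  unfolding differential_def by (metis frechet_derivative_at)

lemma linear_differential: "smooth_fun M W f \<Longrightarrow> linear (differential M f p)"
  by (rule has_derivative_linear[OF differential_has_derivative])

lemma differential_cong:
  assumes "smooth_fun M W f" "\<And>q. q \<in> W \<Longrightarrow> f q = g q"
  shows "differential M g p v = differential M f p v"
proof (rule differential_eqI, rule has_derivative_transform_within_open)
  let ?c = "chart_at M p"
  note c = chart_at[OF M differential_point]
  show "(f \<circ> chart_inv ?c has_derivative differential M f p) (at (snd ?c p))"
    by (rule differential_has_derivative[OF assms(1)])
  show "open (snd ?c ` (fst ?c \<inter> W))" by (rule chart_image_open[OF M c(1) W(1)])
  show "snd ?c p \<in> snd ?c ` (fst ?c \<inter> W)" using c W by auto
  show "(f \<circ> chart_inv ?c) x = (g \<circ> chart_inv ?c) x" if "x \<in> snd ?c ` (fst ?c \<inter> W)" for x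
    using that assms(2) M c by auto
qed

lemma differential_const: "differential M (\<lambda>q. a) p v = 0"
  by (rule differential_eqI) (simp add: o_def)

lemma differential_add:
  "smooth_fun M W f \<Longrightarrow> smooth_fun M W g \<Longrightarrow>
   differential M (\<lambda>q. f q + g q) p v = differential M f p v + differential M g p v"
  using has_derivative_add[OF differential_has_derivative differential_has_derivative]
  by (intro differential_eqI) (simp add: o_def)

lemma differential_mult:
  fixes f g :: "'a \<Rightarrow> real"
  assumes "smooth_fun M W f" "smooth_fun M W g"
  shows "differential M (\<lambda>q. f q * g q) p v = differential M f p v * g p + f p * differential M g p v"
  using has_derivative_mult[OF assms[THEN differential_has_derivative]] M
    chart_at[OF M differential_point]
  by (intro trans[OF differential_eqI]) (auto simp: o_def add.commute)

lemma differential_bounded_linear: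
  assumes "bounded_linear L" "smooth_fun M W f"
  shows "differential M (\<lambda>q. L (f q)) p v = L (differential M f p v)"
  using bounded_linear.has_derivative[OF assms(1) differential_has_derivative[OF assms(2)]]
  by (intro differential_eqI) (simp add: o_def)

lemma differential_sum:
  assumes "finite I" "\<And>i. i \<in> I \<Longrightarrow> smooth_fun M W (f i)"
  shows "differential M (\<lambda>q. \<Sum>i\<in>I. f i q) p v = (\<Sum>i\<in>I. differential M (f i) p v)"
  using assms
  by (induction I rule: finite_induct)
    (auto simp: differential_const differential_add smooth_fun_sum[OF M W(1)])

end

lemma linear_pushforward:
  assumes "smooth_manifold M" "smooth_manifold N" "smooth_map M N F" "p \<in> pts M"
  shows "linear (pushforward M N F p)"
proof -
  let ?d = "chart_at N (F p)"
  have d: "?d \<in> atlas N" "F p \<in> fst ?d"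
    using chart_at[OF assms(2) smooth_map_in_pts[OF assms(3,4)]] by auto
  show ?thesis
    unfolding pushforward_def[abs_def]
    using smooth_map_fun[OF assms(3) d(1)] smooth_map_open[OF assms(3) _ openin_topspace]
      chart_domain[OF assms(2) d(1)] assms d
    by (intro linear_differential[of M "pts M \<inter> F -` fst ?d"]) auto
qed

text \<open>In a fixed chart, \<open>X f\<close> is the derivative of the coordinate expression of
  \<open>f\<close> along the coordinate vector of \<open>X\<close>, and both are smooth
  there.\<close>

lemma smooth_fun_differential:
  assumes "smooth_manifold M" "openin (mtop M) U" "smooth_fun M U f" "smooth_vf M U X"
  shows "smooth_fun M U (\<lambda>q. differential M f q (X q))"
  unfolding smooth_fun_def
proof
  fix c assume c: "c \<in> atlas M"
  let ?S = "snd c ` (fst c \<inter> U)" and ?X = "\<lambda>q. differential M (snd c) q (X q)"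
  have op: "open ?S" by (rule chart_image_open[OF assms(1) c assms(2)])
  have "smooth_on (snd c ` (fst c \<inter> (U \<inter> (\<lambda>q. q) -` fst c))) (?X \<circ> chart_inv c)"
    using assms(4) c unfolding smooth_along_def smooth_fun_def by auto
  moreover have "fst c \<inter> (U \<inter> (\<lambda>q. q) -` fst c) = fst c \<inter> U" by auto
  ultimately have "smooth_on ?S (?X \<circ> chart_inv c)" by simp
  moreover have "smooth_on ?S (f \<circ> chart_inv c)"
    using assms(3) c unfolding smooth_fun_def by auto
  ultimately have "smooth_on ?S (\<lambda>x. frechet_derivative (f \<circ> chart_inv c) (at x) ((?X \<circ> chart_inv c) x))"
    by (intro smooth_on_directional op)
  then show "smooth_on ?S ((\<lambda>q. differential M f q (X q)) \<circ> chart_inv c)"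
    by (rule smooth_on_cong[OF op])
      (use assms c in \<open>auto simp: differential_chart[OF assms(1-3) _ c]\<close>)
qed

text \<open>The field whose coordinate vector in the chart \<open>c\<close> is constantly \<open>u\<close>.\<close>

definition coord_field :: "('a, 'n::euclidean_space) riem \<Rightarrow> ('a, 'n) chart \<Rightarrow> 'n \<Rightarrow> 'a \<Rightarrow> 'n" where
  "coord_field M c u q = frechet_derivative (snd (chart_at M q) \<circ> chart_inv c) (at (snd c q)) u"

context
  fixes M :: "('a, 'n::euclidean_space) riem" and c :: "('a, 'n) chart"
  assumes M: "smooth_manifold M" and c: "c \<in> atlas M"
begin

lemma differential_coord_field:
  assumes "openin (mtop M) W" "smooth_fun M W f" "q \<in> W" "q \<in> fst c"
  shows "differential M f q (coord_field M c u q) =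
    frechet_derivative (f \<circ> chart_inv c) (at (snd c q)) u"
proof -
  have q: "q \<in> pts M" using assms chart_domain[OF M c] by auto
  have "f \<circ> chart_inv c = (f \<circ> (\<lambda>q. q)) \<circ> chart_inv c" by auto
  then show ?thesis
    using has_derivative_chart_compose[OF M M smooth_map_ident[OF M] assms(1,2) q assms(3) c assms(4)
        chart_at[OF M q]]
    unfolding differential_def coord_field_def by (simp add: o_def) (metis frechet_derivative_at)
qed

lemma chart_coord_field:
  assumes "q \<in> fst c"
  shows "differential M (snd c) q (coord_field M c u q) = u"
proof -
  have "(snd c \<circ> chart_inv c has_derivative (\<lambda>v. v)) (at (snd c q))"
    by (rule has_derivative_transform_within_open[OF has_derivative_ident
          chart_image_open[OF M c openin_topspace]])
      (use M c assms chart_domain[OF M c] in auto)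
  then show ?thesis
    using differential_coord_field[OF chart_domain(1)[OF M c] smooth_fun_chart[OF M c] assms assms]
    by (metis frechet_derivative_at)
qed

text \<open>In the chart selected at \<open>q\<close> a tangent vector is its own coordinate vector.
  Rewriting this identity in the chart \<open>c\<close> by the change of charts gives the
  claim.\<close>

lemma coord_field_chart:
  assumes "q \<in> fst c"
  shows "coord_field M c (differential M (snd c) q v) q = v"
proof -
  let ?c = "chart_at M q"
  have q: "q \<in> pts M" using assms chart_domain[OF M c] by auto
  note c0 = chart_at[OF M q]
  have "(snd ?c \<circ> chart_inv ?c has_derivative (\<lambda>v. v)) (at (snd ?c q))"
    by (rule has_derivative_transform_within_open[OF has_derivative_ident
          chart_image_open[OF M c0(1) openin_topspace]])
      (use M c0 q in auto)
  then have "differential M (snd ?c) q v = v"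
    unfolding differential_def by (metis frechet_derivative_at)
  then show ?thesis
    using differential_chart[OF M chart_domain(1)[OF M c0(1)] smooth_fun_chart[OF M c0(1)] c0(2) c assms]
    unfolding coord_field_def by simp
qed

lemma linear_coord_field:
  assumes "q \<in> fst c"
  shows "linear (\<lambda>u. coord_field M c u q)"
proof -
  have q: "q \<in> pts M" using assms chart_domain[OF M c] by auto
  show ?thesis
    unfolding coord_field_def
    using smooth_fun_has_derivative[OF smooth_fun_chart[OF M chart_at(1)[OF M q]] chart_at(2)[OF M q]
        c assms]
    by (rule has_derivative_linear)
qed

text \<open>Makes the coordinate fields a local frame of the tangent bundle. Its coefficients are
  the coordinates in \<open>c\<close>, so they are smooth for a smooth field; metrics and
  connections are computed through this frame.\<close>

lemma coord_field_expansion: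
  assumes "q \<in> fst c"
  shows "v = (\<Sum>b\<in>Basis. (differential M (snd c) q v \<bullet> b) *\<^sub>R coord_field M c b q)"
  using linear_sum_Basis[OF linear_coord_field[OF assms], of "differential M (snd c) q v"]
  by (simp add: coord_field_chart assms)

text \<open>In another chart \<open>d\<close> the coordinates of this field are a directional
  derivative of the transition map.\<close>

lemma smooth_coord_field: "smooth_vf M (fst c) (coord_field M c u)"
  unfolding smooth_along_def
proof
  fix d assume d: "d \<in> atlas M"
  let ?W = "fst c \<inter> (\<lambda>q. q) -` fst d"
  have op: "openin (mtop M) ?W"
    using openin_Int[OF chart_domain(1)[OF M c] chart_domain(1)[OF M d]] by (simp add: vimage_def)
  have "smooth_on (snd c ` ?W) (snd d \<circ> chart_inv c)"
    using smooth_fun_chart[OF M d] c unfolding smooth_fun_def by (simp add: vimage_def)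
  from smooth_on_frechet_derivative[OF this, of u]
  have "smooth_fun M ?W (\<lambda>q. frechet_derivative (snd d \<circ> chart_inv c) (at (snd c q)) u)"
    by (rule smooth_fun_in_chart[OF M c op Int_lower1])
  then show "smooth_fun M ?W (\<lambda>q. differential M (snd d) q (coord_field M c u q))"
    by (rule smooth_fun_cong[OF M op])
      (auto simp: differential_coord_field[OF chart_domain(1)[OF M d] smooth_fun_chart[OF M d]])
qed

end

lemma tangent_eqI:
  assumes "smooth_manifold M" "c \<in> atlas M" "q \<in> fst c"
    and "differential M (snd c) q v = differential M (snd c) q w"
  shows "v = w"
  using coord_field_chart[OF assms(1-3)] assms(4) by metis

section \<open>Sections along a map\<close>

lemma smooth_along_subset: "smooth_along M N F W V \<Longrightarrow> U \<subseteq> W \<Longrightarrow> smooth_along M N F U V"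
  unfolding smooth_along_def by (blast intro: smooth_fun_subset)

lemma bilinear_double_sum:
  fixes h :: "'e::real_vector \<Rightarrow> 'f::real_vector \<Rightarrow> real"
  assumes "bilinear h"
  shows "h (\<Sum>i\<in>I. x i *\<^sub>R e i) (\<Sum>j\<in>J. y j *\<^sub>R f j) = (\<Sum>i\<in>I. \<Sum>j\<in>J. x i * y j * h (e i) (f j))"
proof -
  have "linear (\<lambda>v. h v w)" "linear (h v)" for v w
    using assms unfolding bilinear_def by auto
  then have l: "h (\<Sum>i\<in>I. x i *\<^sub>R e i) w = (\<Sum>i\<in>I. x i * h (e i) w)"
    and r: "h v (\<Sum>j\<in>J. y j *\<^sub>R f j) = (\<Sum>j\<in>J. y j * h v (f j))" for v w
    by (simp_all add: linear_sum[of "\<lambda>v. h v w"] linear_cmul[of "\<lambda>v. h v w"]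
        linear_sum[of "h v"] linear_cmul[of "h v"])
  show ?thesis
    unfolding l by (simp add: r sum_distrib_left mult.assoc)
qed

lemma levi_civita_connection: "levi_civita M D \<Longrightarrow> connection_along M M (\<lambda>q. q) D"
  unfolding levi_civita_def by simp

lemma levi_civita_metric:
  assumes "levi_civita M D" "openin (mtop M) U" "smooth_vf M U X" "smooth_vf M U Y" "p \<in> U"
  shows "differential M (\<lambda>q. metric M q (X q) (Y q)) p v =
    metric M p (D p v X) (Y p) + metric M p (X p) (D p v Y)"
  using assms unfolding levi_civita_def by blast

lemma levi_civita_torsion:
  fixes f :: "'a \<Rightarrow> real"
  assumes "levi_civita M D" "openin (mtop M) U" "smooth_vf M U X" "smooth_vf M U Y"
    "smooth_fun M U f" "p \<in> U"
  shows "differential M f p (D p (X p) Y - D p (Y p) X) =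
    differential M (\<lambda>q. differential M f q (Y q)) p (X p)
    - differential M (\<lambda>q. differential M f q (X q)) p (Y p)"
  using assms unfolding levi_civita_def by blast

lemma connection_facts:
  assumes "connection_along M N F DF" "openin (mtop M) U" "smooth_along M N F U V" "p \<in> U"
  shows connection_linear: "linear (\<lambda>v. DF p v V)"
    and connection_germ: "(\<And>q. q \<in> U \<Longrightarrow> W q = V q) \<Longrightarrow> DF p v W = DF p v V"
    and connection_add: "smooth_along M N F U W \<Longrightarrow> DF p v (\<lambda>q. V q + W q) = DF p v V + DF p v W"
    and connection_scaleR: "smooth_fun M U f \<Longrightarrow>
      DF p v (\<lambda>q. f q *\<^sub>R V q) = differential M f p v *\<^sub>R V p + f p *\<^sub>R DF p v V"
    and connection_smooth: "smooth_vf M U X \<Longrightarrow> smooth_along M N F U (\<lambda>q. DF q (X q) V)"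
proof -
  note C = assms(1)[unfolded connection_along_def, THEN spec, THEN spec, THEN mp, OF conjI[OF assms(2,3)]]
  show "linear (\<lambda>v. DF p v V)"
    using C[THEN conjunct1] assms(4) by simp
  show "(\<And>q. q \<in> U \<Longrightarrow> W q = V q) \<Longrightarrow> DF p v W = DF p v V"
    using C[THEN conjunct2, THEN conjunct1, THEN spec, of W] assms(4) by simp
  show "smooth_along M N F U W \<Longrightarrow> DF p v (\<lambda>q. V q + W q) = DF p v V + DF p v W"
    using C[THEN conjunct2, THEN conjunct2, THEN conjunct1, THEN spec, of W] assms(4) by simp
  show "smooth_fun M U f \<Longrightarrow>
      DF p v (\<lambda>q. f q *\<^sub>R V q) = differential M f p v *\<^sub>R V p + f p *\<^sub>R DF p v V"
    using C[THEN conjunct2, THEN conjunct2, THEN conjunct2, THEN conjunct1, THEN spec, of f] assms(4)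
    by simp
  show "smooth_vf M U X \<Longrightarrow> smooth_along M N F U (\<lambda>q. DF q (X q) V)"
    using C[THEN conjunct2, THEN conjunct2, THEN conjunct2, THEN conjunct2, THEN spec, of X] by simp
qed

locale manifold_map =
  fixes M :: "('a, 'n::euclidean_space) riem" and N :: "('b, 'm::euclidean_space) riem"
    and F :: "'a \<Rightarrow> 'b"
  assumes M: "smooth_manifold M" and N: "smooth_manifold N" and F: "smooth_map M N F"
begin

lemma open_preimage_chart:
  "openin (mtop M) U \<Longrightarrow> d \<in> atlas N \<Longrightarrow> openin (mtop M) (U \<inter> F -` fst d)"
  by (rule smooth_map_open[OF F chart_domain(1)[OF N]])

lemma linear_chart: "d \<in> atlas N \<Longrightarrow> F q \<in> fst d \<Longrightarrow> linear (differential N (snd d) (F q))"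
  by (rule linear_differential[OF N chart_domain(1)[OF N] _ smooth_fun_chart[OF N]])

lemma smooth_alongD:
  "smooth_along M N F U V \<Longrightarrow> d \<in> atlas N \<Longrightarrow>
   smooth_fun M (U \<inter> F -` fst d) (\<lambda>q. differential N (snd d) (F q) (V q))"
  unfolding smooth_along_def by auto

lemma smooth_along_coeff:
  assumes "openin (mtop M) U" "smooth_along M N F U V" "d \<in> atlas N"
  shows "smooth_fun M (U \<inter> F -` fst d) (\<lambda>q. differential N (snd d) (F q) (V q) \<bullet> b)"
  by (rule smooth_fun_bounded_linear[OF M open_preimage_chart[OF assms(1,3)]
        bounded_linear_inner_left smooth_alongD[OF assms(2,3)]])

lemma smooth_along_cong:
  assumes "openin (mtop M) U" "smooth_along M N F U V" "\<And>q. q \<in> U \<Longrightarrow> V q = W q"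
  shows "smooth_along M N F U W"
  unfolding smooth_along_def
proof
  fix d assume d: "d \<in> atlas N"
  show "smooth_fun M (U \<inter> F -` fst d) (\<lambda>q. differential N (snd d) (F q) (W q))"
    by (rule smooth_fun_cong[OF M open_preimage_chart[OF assms(1) d] smooth_alongD[OF assms(2) d]])
      (simp add: assms(3))
qed

lemma smooth_along_local:
  assumes loc: "\<And>q. q \<in> W \<Longrightarrow> \<exists>U. openin (mtop M) U \<and> q \<in> U \<and> smooth_along M N F U V"
  shows "smooth_along M N F W V"
  unfolding smooth_along_def
proof (intro ballI smooth_fun_local[OF M])
  fix d q assume d: "d \<in> atlas N" and q: "q \<in> W \<inter> F -` fst d"
  with loc obtain U where "openin (mtop M) U" "q \<in> U" "smooth_along M N F U V" by blast
  with d q show "\<exists>U. openin (mtop M) U \<and> q \<in> U \<and>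
      smooth_fun M U (\<lambda>q. differential N (snd d) (F q) (V q))"
    by (intro exI[of _ "U \<inter> F -` fst d"]) (auto intro: open_preimage_chart smooth_alongD)
qed

lemma smooth_along_zero: "openin (mtop M) U \<Longrightarrow> smooth_along M N F U (\<lambda>q. 0)"
  unfolding smooth_along_def
proof
  fix d assume U: "openin (mtop M) U" and d: "d \<in> atlas N"
  note op = open_preimage_chart[OF U d]
  show "smooth_fun M (U \<inter> F -` fst d) (\<lambda>q. differential N (snd d) (F q) 0)"
    by (rule smooth_fun_cong[OF M op smooth_fun_const[OF M op, of 0]])
      (use d in \<open>simp add: linear_0[OF linear_chart]\<close>)
qed

lemma smooth_along_add:
  assumes "openin (mtop M) U" "smooth_along M N F U V" "smooth_along M N F U W"
  shows "smooth_along M N F U (\<lambda>q. V q + W q)"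
  unfolding smooth_along_def
proof
  fix d assume d: "d \<in> atlas N"
  note op = open_preimage_chart[OF assms(1) d]
  show "smooth_fun M (U \<inter> F -` fst d) (\<lambda>q. differential N (snd d) (F q) (V q + W q))"
    by (rule smooth_fun_cong[OF M op smooth_fun_add[OF M op assms(2,3)[THEN smooth_alongD, OF d]]])
      (use d in \<open>simp add: linear_add[OF linear_chart]\<close>)
qed

lemma smooth_along_scaleR:
  assumes "openin (mtop M) U" "smooth_fun M U f" "smooth_along M N F U V"
  shows "smooth_along M N F U (\<lambda>q. f q *\<^sub>R V q)"
  unfolding smooth_along_def
proof
  fix d assume d: "d \<in> atlas N"
  note op = open_preimage_chart[OF assms(1) d]
  show "smooth_fun M (U \<inter> F -` fst d) (\<lambda>q. differential N (snd d) (F q) (f q *\<^sub>R V q))"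
    by (rule smooth_fun_cong[OF M op smooth_fun_scaleR[OF M op
            smooth_fun_subset[OF assms(2) Int_lower1] smooth_alongD[OF assms(3) d]]])
      (use d in \<open>simp add: linear_cmul[OF linear_chart]\<close>)
qed

lemma smooth_along_sum:
  assumes "openin (mtop M) U" "\<And>i. i \<in> I \<Longrightarrow> smooth_along M N F U (V i)"
  shows "smooth_along M N F U (\<lambda>q. \<Sum>i\<in>I. V i q)"
  using assms(2)
  by (induction I rule: infinite_finite_induct)
    (auto intro: smooth_along_zero smooth_along_add assms(1))

lemma smooth_along_compose:
  assumes "openin (mtop N) W" "smooth_vf N W Y"
  shows "smooth_along M N F (pts M \<inter> F -` W) (\<lambda>q. Y (F q))"
  unfolding smooth_along_def
proof
  fix d assume d: "d \<in> atlas N"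
  have "smooth_fun N (W \<inter> fst d) (\<lambda>q. differential N (snd d) q (Y q))"
    using assms(2) d unfolding smooth_along_def by (simp add: vimage_def)
  from smooth_fun_compose[OF M N F openin_Int[OF assms(1) chart_domain(1)[OF N d]] this]
  show "smooth_fun M (pts M \<inter> F -` W \<inter> F -` fst d) (\<lambda>q. differential N (snd d) (F q) (Y (F q)))"
    by (simp add: vimage_Int Int_assoc)
qed

lemma smooth_along_coord_field:
  assumes "openin (mtop M) U" "d \<in> atlas N"
  shows "smooth_along M N F (U \<inter> F -` fst d) (\<lambda>q. coord_field N d b (F q))"
  by (rule smooth_along_subset[OF smooth_along_compose[OF chart_domain(1)[OF N assms(2)]
          smooth_coord_field[OF N assms(2)]]])
    (use openin_subset[OF assms(1)] in auto)

lemma pushforward_chart: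
  assumes "p \<in> pts M" "d \<in> atlas N" "F p \<in> fst d"
  shows "differential N (snd d) (F p) (pushforward M N F p v) = differential M (snd d \<circ> F) p v"
  using differential_compose[OF M N F chart_domain(1)[OF N assms(2)] smooth_fun_chart[OF N assms(2)]
      assms(1,3)]
  by (simp add: o_def)

lemma smooth_along_pushforward:
  assumes "openin (mtop M) U" "smooth_vf M U X"
  shows "smooth_along M N F U (\<lambda>q. pushforward M N F q (X q))"
  unfolding smooth_along_def
proof
  fix d assume d: "d \<in> atlas N"
  let ?U = "U \<inter> F -` fst d"
  have U: "U \<subseteq> pts M" by (rule openin_subset[OF assms(1)])
  note op = open_preimage_chart[OF assms(1) d]
  have "smooth_fun M ?U (\<lambda>q. differential M (snd d \<circ> F) q (X q))"
    using U smooth_map_fun[OF F d] assms(2)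
    by (intro smooth_fun_differential[OF M op])
      (auto elim: smooth_fun_subset smooth_along_subset)
  then show "smooth_fun M ?U (\<lambda>q. differential N (snd d) (F q) (pushforward M N F q (X q)))"
    by (rule smooth_fun_cong[OF M op]) (use d U in \<open>auto simp: pushforward_chart\<close>)
qed

lemma connection_sum:
  assumes "connection_along M N F DF" "openin (mtop M) U" "p \<in> U" "finite I"
    and "\<And>i. i \<in> I \<Longrightarrow> smooth_fun M U (f i)" "\<And>i. i \<in> I \<Longrightarrow> smooth_along M N F U (Y i)"
  shows "DF p v (\<lambda>q. \<Sum>i\<in>I. f i q *\<^sub>R Y i q)
    = (\<Sum>i\<in>I. differential M (f i) p v *\<^sub>R Y i p + f i p *\<^sub>R DF p v (Y i))"
  using assms(4-6)
proof (induction I rule: finite_induct)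
  case empty
  \<comment> \<open>Writing the zero section as a multiple of itself by the function 0 lets the
    Leibniz rule show that its derivative vanishes.\<close>
  have "DF p v (\<lambda>q. 0 *\<^sub>R 0) = differential M (\<lambda>q. 0) p v *\<^sub>R 0 + 0 *\<^sub>R DF p v (\<lambda>q. 0)"
    by (rule connection_scaleR[OF assms(1,2) smooth_along_zero[OF assms(2)] assms(3)
          smooth_fun_const[OF M assms(2)]])
  then show ?case by simp
next
  case (insert i I)
  have "smooth_along M N F U (\<lambda>q. f i q *\<^sub>R Y i q)"
    "smooth_along M N F U (\<lambda>q. \<Sum>i\<in>I. f i q *\<^sub>R Y i q)"
    using insert.prems by (auto intro!: smooth_along_scaleR smooth_along_sum assms(2))
  from connection_add[OF assms(1,2) this(1) assms(3) this(2)]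
  have "DF p v (\<lambda>q. f i q *\<^sub>R Y i q + (\<Sum>i\<in>I. f i q *\<^sub>R Y i q)) =
     DF p v (\<lambda>q. f i q *\<^sub>R Y i q) + DF p v (\<lambda>q. \<Sum>i\<in>I. f i q *\<^sub>R Y i q)" .
  moreover have "DF p v (\<lambda>q. f i q *\<^sub>R Y i q) =
     differential M (f i) p v *\<^sub>R Y i p + f i p *\<^sub>R DF p v (Y i)"
    using insert.prems by (intro connection_scaleR[OF assms(1,2) _ assms(3)]) auto
  ultimately show ?case
    using insert by simp
qed

end

section \<open>The metric of the target on sections along a map\<close>

locale riemannian_target = manifold_map +
  assumes N_riem: "riemannian_manifold N"
begin

lemma metric_bilinear: "p \<in> pts N \<Longrightarrow> bilinear (metric N p)"
  and metric_sym: "p \<in> pts N \<Longrightarrow> metric N p v w = metric N p w v"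
  and metric_pos: "p \<in> pts N \<Longrightarrow> v \<noteq> 0 \<Longrightarrow> 0 < metric N p v v"
  using N_riem unfolding riemannian_manifold_def by auto

lemma smooth_metric_coord_field:
  assumes "d \<in> atlas N"
  shows "smooth_fun N (fst d) (\<lambda>q. metric N q (coord_field N d b q) (coord_field N d c q))"
  using N_riem chart_domain(1)[OF N assms] smooth_coord_field[OF N assms]
  unfolding riemannian_manifold_def by blast

lemma metric_coord_expansion:
  assumes "d \<in> atlas N" "q \<in> fst d"
  shows "metric N q v w =
    (\<Sum>b\<in>Basis. \<Sum>c\<in>Basis. (differential N (snd d) q v \<bullet> b) * (differential N (snd d) q w \<bullet> c) *
      metric N q (coord_field N d b q) (coord_field N d c q))"
proof -
  have "q \<in> pts N" using assms chart_domain[OF N] by blast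
  from bilinear_double_sum[OF metric_bilinear[OF this]] show ?thesis
    by (subst (1) coord_field_expansion[OF N assms, of v], subst (1) coord_field_expansion[OF N assms, of w])
qed

text \<open>Smoothness of the metric is given for vector fields on \<open>N\<close>, not for
  sections along \<open>F\<close>. Near \<open>p\<close> both sections are expanded in coordinate
  fields composed with \<open>F\<close>, which leaves smooth coefficients and the pulled back Gram
  matrix.\<close>

lemma smooth_metric_along:
  assumes U: "openin (mtop M) U" and "smooth_along M N F U V" "smooth_along M N F U W"
  shows "smooth_fun M U (\<lambda>q. metric N (F q) (V q) (W q))"
proof (rule smooth_fun_local[OF M])
  fix p assume p: "p \<in> U"
  then have "F p \<in> pts N" using openin_subset[OF U] smooth_map_in_pts[OF F] by blast
  then obtain d where d: "d \<in> atlas N" "F p \<in> fst d" using chart_at[OF N] by blast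
  let ?U = "U \<inter> F -` fst d"
  note op = open_preimage_chart[OF U d(1)]
  have "smooth_fun M ?U (\<lambda>q. metric N (F q) (coord_field N d b (F q)) (coord_field N d c (F q)))" for b c
    by (rule smooth_fun_subset[OF smooth_fun_compose[OF M N F chart_domain(1)[OF N d(1)]
            smooth_metric_coord_field[OF d(1)]]])
      (use openin_subset[OF U] in auto)
  then have "smooth_fun M ?U (\<lambda>q. \<Sum>b\<in>Basis. \<Sum>c\<in>Basis.
      ((differential N (snd d) (F q) (V q) \<bullet> b) *\<^sub>R (differential N (snd d) (F q) (W q) \<bullet> c)) *\<^sub>R
      metric N (F q) (coord_field N d b (F q)) (coord_field N d c (F q)))"
    by (intro smooth_fun_sum smooth_fun_scaleR M op smooth_along_coeff[OF U] assms d) auto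
  then have "smooth_fun M ?U (\<lambda>q. metric N (F q) (V q) (W q))"
    by (rule smooth_fun_cong[OF M op]) (use d in \<open>simp add: metric_coord_expansion[of d]\<close>)
  with op p d show "\<exists>U. openin (mtop M) U \<and> p \<in> U \<and> smooth_fun M U (\<lambda>q. metric N (F q) (V q) (W q))"
    by blast
qed

end

section \<open>Coordinate expression and metric property of the pullback connection\<close>

locale pullback = riemannian_target +
  fixes D2 DF
  assumes D2: "levi_civita N D2" and DF: "pullback_connection M N F D2 DF"
begin

lemma DF_connection: "connection_along M N F DF"
  using DF unfolding pullback_connection_def by simp

lemma DF_coord_field:
  assumes "p \<in> pts M" "d \<in> atlas N" "F p \<in> fst d"
  shows "DF p v (\<lambda>q. coord_field N d b (F q)) = D2 (F p) (pushforward M N F p v) (coord_field N d b)"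
  using DF chart_domain(1)[OF N assms(2)] smooth_coord_field[OF N assms(2)] assms
  unfolding pullback_connection_def by blast

text \<open>The chain rule fixes the pullback connection on sections \<open>Y \<circ> F\<close>
  only. Near \<open>p\<close> every section is a combination of composed coordinate fields, so
  dependence on the germ and the Leibniz rule determine it everywhere.\<close>

lemma DF_expansion:
  assumes "openin (mtop M) U" "smooth_along M N F U V" "p \<in> U" "d \<in> atlas N" "F p \<in> fst d"
    and x_def: "\<And>b q. x b q = differential N (snd d) (F q) (V q) \<bullet> b"
  shows "DF p v V = (\<Sum>b\<in>Basis. differential M (x b) p v *\<^sub>R coord_field N d b (F p)
    + x b p *\<^sub>R D2 (F p) (pushforward M N F p v) (coord_field N d b))"
proof -
  let ?U = "U \<inter> F -` fst d"
  let ?V = "\<lambda>q. \<Sum>b\<in>Basis. x b q *\<^sub>R coord_field N d b (F q)"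
  note op = open_preimage_chart[OF assms(1,4)]
  have p: "p \<in> pts M" "p \<in> ?U" using openin_subset[OF assms(1)] assms by auto
  have x: "smooth_fun M ?U (x b)" for b
    using smooth_along_coeff[OF assms(1,2,4), of b] by (simp add: x_def[abs_def])
  have E: "smooth_along M N F ?U (\<lambda>q. coord_field N d b (F q))" for b
    by (rule smooth_along_coord_field[OF assms(1,4)])
  have "DF p v V = DF p v ?V"
  proof (rule connection_germ[OF DF_connection op _ p(2)])
    show "smooth_along M N F ?U ?V"
      by (intro smooth_along_sum smooth_along_scaleR op x E)
    show "V q = ?V q" if "q \<in> ?U" for q
      using that coord_field_expansion[OF N assms(4), of "F q" "V q"] by (simp add: x_def)
  qed
  also have "\<dots> = (\<Sum>b\<in>Basis. differential M (x b) p v *\<^sub>R coord_field N d b (F p)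
    + x b p *\<^sub>R DF p v (\<lambda>q. coord_field N d b (F q)))"
    by (rule connection_sum[OF DF_connection op p(2)]) (auto intro: x E)
  finally show ?thesis
    by (simp add: DF_coord_field[OF p(1) assms(4,5)])
qed

lemma pullback_metric:
  assumes U: "openin (mtop M) U" and V: "smooth_along M N F U V" and W: "smooth_along M N F U W"
    and p: "p \<in> U"
  shows "differential M (\<lambda>q. metric N (F q) (V q) (W q)) p v =
    metric N (F p) (DF p v V) (W p) + metric N (F p) (V p) (DF p v W)"
proof -
  have pM: "p \<in> pts M" using openin_subset[OF U] p by auto
  then have FpN: "F p \<in> pts N" using smooth_map_in_pts[OF F] by blast
  then obtain d where d: "d \<in> atlas N" "F p \<in> fst d" using chart_at[OF N] by blast
  let ?U = "U \<inter> F -` fst d"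
  note op = open_preimage_chart[OF U d(1)]
  have pU: "p \<in> ?U" using p d by auto
  define E where "E = coord_field N d"
  define x where "x b q = differential N (snd d) (F q) (V q) \<bullet> b" for b q
  define y where "y b q = differential N (snd d) (F q) (W q) \<bullet> b" for b q
  define G where "G b c q = metric N q (E b q) (E c q)" for b c q
  define D where "D b = D2 (F p) (pushforward M N F p v) (E b)" for b
  have sm: "smooth_fun M ?U (x b)" "smooth_fun M ?U (y b)" "smooth_fun N (fst d) (G b c)" for b c
    unfolding x_def y_def G_def E_def
    by (rule smooth_along_coeff[OF U V d(1)] smooth_along_coeff[OF U W d(1)]
        smooth_metric_coord_field[OF d(1)])+
  have GF: "smooth_fun M ?U (\<lambda>q. G b c (F q))" for b c
    by (rule smooth_fun_subset[OF smooth_fun_compose[OF M N F chart_domain(1)[OF N d(1)] sm(3)]])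
      (use openin_subset[OF U] in auto)
  have xy: "smooth_fun M ?U (\<lambda>q. x b q * y c q)" for b c
    using smooth_fun_scaleR[OF M op sm(1,2)] by simp
  have xyG: "smooth_fun M ?U (\<lambda>q. x b q * y c q * G b c (F q))" for b c
    using smooth_fun_scaleR[OF M op xy GF] by simp
  \<comment> \<open>The metric property of \<open>D2\<close> enters here, applied to coordinate
    fields on \<open>N\<close> in the direction \<open>F_* v\<close>. Everything else is the product
    rule and the collection of terms.\<close>
  have dG: "differential M (\<lambda>q. G b c (F q)) p v =
      metric N (F p) (D b) (E c (F p)) + metric N (F p) (E b (F p)) (D c)" for b c
    using differential_compose[OF M N F chart_domain(1)[OF N d(1)] sm(3) pM d(2), of b c v]
      levi_civita_metric[OF D2 chart_domain(1)[OF N d(1)] smooth_coord_field[OF N d(1), of b]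
        smooth_coord_field[OF N d(1), of c] d(2)]
    unfolding G_def[abs_def] D_def E_def by simp
  have "differential M (\<lambda>q. metric N (F q) (V q) (W q)) p v =
      differential M (\<lambda>q. \<Sum>b\<in>Basis. \<Sum>c\<in>Basis. x b q * y c q * G b c (F q)) p v"
    by (rule differential_cong[OF M op pU])
      (auto simp: x_def y_def G_def E_def metric_coord_expansion[OF d(1)] xyG[unfolded x_def y_def G_def E_def]
        intro!: smooth_fun_sum M op)
  also have "\<dots> = (\<Sum>b\<in>Basis. \<Sum>c\<in>Basis. differential M (\<lambda>q. x b q * y c q * G b c (F q)) p v)"
    by (simp add: differential_sum[OF M op pU] smooth_fun_sum[OF M op] xyG)
  also have "\<dots> = (\<Sum>b\<in>Basis. \<Sum>c\<in>Basis.
      (differential M (x b) p v * y c p + x b p * differential M (y c) p v) * G b c (F p)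
      + x b p * y c p * (metric N (F p) (D b) (E c (F p)) + metric N (F p) (E b (F p)) (D c)))"
    by (simp add: differential_mult[OF M op pU] xy GF sm dG)
  also have "\<dots> = metric N (F p) (DF p v V) (W p) + metric N (F p) (V p) (DF p v W)"
  proof -
    have DV: "DF p v V = (\<Sum>b\<in>Basis. differential M (x b) p v *\<^sub>R E b (F p)) + (\<Sum>b\<in>Basis. x b p *\<^sub>R D b)"
      and DW: "DF p v W = (\<Sum>b\<in>Basis. differential M (y b) p v *\<^sub>R E b (F p)) + (\<Sum>b\<in>Basis. y b p *\<^sub>R D b)"
      using DF_expansion[OF U V p d x_def] DF_expansion[OF U W p d y_def]
      unfolding D_def E_def by (simp_all add: sum.distrib)
    have Vp: "V p = (\<Sum>b\<in>Basis. x b p *\<^sub>R E b (F p))" and Wp: "W p = (\<Sum>b\<in>Basis. y b p *\<^sub>R E b (F p))"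
      unfolding x_def y_def E_def by (rule coord_field_expansion[OF N d])+
    note bil = metric_bilinear[OF FpN]
    show ?thesis
      unfolding DV DW Vp Wp bilinear_ladd[OF bil] bilinear_radd[OF bil] bilinear_double_sum[OF bil]
        G_def by (simp add: sum.distrib[symmetric] algebra_simps)
  qed
  finally show ?thesis .
qed

end

text \<open>The function is supported in a compact coordinate ball \<open>K\<close> inside
  \<open>U\<close>, and \<open>W\<close> is the complement of \<open>K\<close>. The open cover by
  \<open>U\<close> and \<open>W\<close> is part of the result because it is what makes
  \<open>\<eta>\<close> times a field on \<open>U\<close>, extended by zero, smooth on all of
  \<open>M\<close>.\<close>

lemma manifold_bump:
  fixes M :: "('a, 'n::euclidean_space) riem"
  assumes M: "smooth_manifold M" and U: "openin (mtop M) U" "p \<in> U"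
  obtains \<eta> :: "'a \<Rightarrow> real" and W where "smooth_fun M (pts M) \<eta>" "\<eta> p = 1" "openin (mtop M) W"
    "U \<union> W = pts M" "\<And>q. q \<in> W \<Longrightarrow> \<eta> q = 0"
proof -
  have UM: "U \<subseteq> pts M" by (rule openin_subset[OF U(1)])
  then obtain c where c: "c \<in> atlas M" "p \<in> fst c" using chart_at[OF M] U(2) by blast
  let ?V = "fst c \<inter> U"
  have opV: "openin (mtop M) ?V" by (rule openin_Int[OF chart_domain(1)[OF M c(1)] U(1)])
  have "open (snd c ` ?V)" by (rule chart_image_open[OF M c(1) U(1)])
  moreover have "snd c p \<in> snd c ` ?V" using c U by auto
  ultimately obtain \<epsilon> where \<epsilon>: "0 < \<epsilon>" "cball (snd c p) \<epsilon> \<subseteq> snd c ` ?V"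
    using open_contains_cball by blast
  obtain \<psi> :: "_ \<Rightarrow> real" where \<psi>: "smooth_on UNIV \<psi>" "\<psi> (snd c p) = 1"
    "\<And>y. y \<notin> cball (snd c p) \<epsilon> \<Longrightarrow> \<psi> y = 0"
    using smooth_bump[OF \<epsilon>(1)] by metis
  define K where "K = chart_inv c ` cball (snd c p) \<epsilon>"
  have KV: "K \<subseteq> ?V"
  proof
    fix q assume "q \<in> K"
    then obtain q' where "q' \<in> ?V" "q = chart_inv c (snd c q')"
      using \<epsilon>(2) unfolding K_def by blast
    then show "q \<in> ?V" using M c by auto
  qed
  have "homeomorphic_map (subtopology (mtop M) (fst c)) (top_of_set (snd c ` fst c)) (snd c)"
    using M c unfolding smooth_manifold_def is_chart_def by auto
  moreover have top: "topspace (subtopology (mtop M) (fst c)) = fst c"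
    using chart_domain(2)[OF M c(1)] by auto
  moreover have "snd c ` K = cball (snd c p) \<epsilon>"
    unfolding K_def image_image
  proof -
    have "snd c (chart_inv c y) = y" if "y \<in> cball (snd c p) \<epsilon>" for y
      using that \<epsilon>(2) by (intro f_inv_into_f) auto
    then show "(\<lambda>y. snd c (chart_inv c y)) ` cball (snd c p) \<epsilon> = cball (snd c p) \<epsilon>" by auto
  qed
  moreover have "compactin (top_of_set (snd c ` fst c)) (cball (snd c p) \<epsilon>)"
    using \<epsilon>(2) by (auto simp: compactin_subtopology)
  ultimately have "compactin (subtopology (mtop M) (fst c)) K"
    using homeomorphic_map_compactness[of _ _ "snd c" K] KV by auto
  then have "compactin (mtop M) K" by (simp add: compactin_subtopology)
  \<comment> \<open>The Hausdorff property is used here; without a closed \<open>K\<close> its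
    complement need not be open.\<close>
  then have closed: "closedin (mtop M) K"
    using compactin_imp_closedin M unfolding smooth_manifold_def by blast
  define W where "W = pts M - K"
  have opW: "openin (mtop M) W" unfolding W_def using closed by (simp add: closedin_def)
  define \<eta> where "\<eta> q = (if q \<in> ?V then \<psi> (snd c q) else 0)" for q
  have W0: "\<eta> q = 0" if "q \<in> W" for q
  proof (cases "q \<in> ?V")
    case True
    have "snd c q \<notin> cball (snd c p) \<epsilon>"
    proof
      assume "snd c q \<in> cball (snd c p) \<epsilon>"
      then have "chart_inv c (snd c q) \<in> K" unfolding K_def by blast
      then show False using True M c that unfolding W_def by auto
    qed
    then show ?thesis using \<psi>(3) by (simp add: \<eta>_def)
  qed (auto simp: \<eta>_def)
  have "smooth_fun M ?V (\<lambda>q. \<psi> (snd c q))"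
    by (rule smooth_fun_in_chart[OF M c(1) opV Int_lower1 smooth_on_subset[OF \<psi>(1)]]) simp
  then have "smooth_fun M ?V \<eta>" by (rule smooth_fun_cong[OF M opV]) (simp add: \<eta>_def)
  moreover have "smooth_fun M W \<eta>"
    by (rule smooth_fun_cong[OF M opW smooth_fun_const[OF M opW, of 0]]) (simp add: W0)
  moreover have "?V \<union> W = pts M"
    using KV UM openin_subset[OF opW] unfolding W_def by auto
  ultimately have "smooth_fun M (pts M) \<eta>"
    using opV opW by (intro smooth_fun_local[OF M]) blast
  then show ?thesis
    using that[of \<eta> W] \<psi>(2) c U opW W0 KV UM openin_subset[OF opW]
    by (auto simp: \<eta>_def W_def)
qed

section \<open>Orthonormal frames\<close>

text \<open>Smooth functions are continuous in charts. This allows shrinking a neighbourhood to the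
  set where a length stays positive.\<close>

lemma smooth_fun_open_preimage:
  assumes "smooth_manifold M" "openin (mtop M) U" "smooth_fun M U f" "open B"
  shows "openin (mtop M) (U \<inter> f -` B)"
proof (subst openin_subopen, intro ballI)
  fix p assume p: "p \<in> U \<inter> f -` B"
  then have "p \<in> pts M" using openin_subset[OF assms(2)] by auto
  then obtain c where c: "c \<in> atlas M" "p \<in> fst c" using chart_at[OF assms(1)] by blast
  let ?S = "snd c ` (fst c \<inter> U)"
  let ?O = "?S \<inter> (f \<circ> chart_inv c) -` B"
  have op: "open ?S" by (rule chart_image_open[OF assms(1) c(1) assms(2)])
  have "smooth_on ?S (f \<circ> chart_inv c)"
    using assms(3) c(1) unfolding smooth_fun_def by auto
  then have "continuous_on ?S (f \<circ> chart_inv c)"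
    unfolding smooth_on_def by (metis Ck_on.simps(1))
  then have "open ?O"
    using continuous_open_preimage[OF _ op assms(4)] by blast
  from chart_preimage_open[OF assms(1) c(1) this]
  have "openin (mtop M) (fst c \<inter> snd c -` ?O)" .
  moreover have "p \<in> fst c \<inter> snd c -` ?O"
    using p c assms(1) by auto
  moreover have "fst c \<inter> snd c -` ?O \<subseteq> U \<inter> f -` B"
    using chart_inj[OF assms(1) c(1)] assms(1) c(1) by (auto dest: inj_onD)
  ultimately show "\<exists>T. openin (mtop M) T \<and> p \<in> T \<and> T \<subseteq> U \<inter> f -` B"
    by blast
qed

text \<open>Nothing is required about the span, because the same orthonormalisation serves the whole
  tangent bundle and the horizontal spaces.\<close>

definition orthonormal_frame ::
  "('a, 'n::euclidean_space) riem \<Rightarrow> nat \<Rightarrow> 'a set \<Rightarrow> (nat \<Rightarrow> 'a \<Rightarrow> 'n) \<Rightarrow> bool" where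
  "orthonormal_frame M n U e \<longleftrightarrow> (\<forall>i<n. smooth_vf M U (e i)) \<and>
     (\<forall>q\<in>U. \<forall>i<n. \<forall>j<n. metric M q (e i q) (e j q) = (if i = j then 1 else 0))"

locale riemannian =
  fixes M :: "('a, 'n::euclidean_space) riem"
  assumes M_riem: "riemannian_manifold M"
begin

text \<open>Vector fields are the sections along the identity, so the whole calculus of sections
  becomes available for them under the prefix \<open>vf\<close>.\<close>

sublocale vf: riemannian_target M M "\<lambda>q. q"
  using M_riem smooth_map_ident
  by unfold_locales (auto simp: riemannian_manifold_def)

lemma orthonormal_expansion:
  fixes n :: nat
  assumes "q \<in> pts M"
    and orth: "\<And>i j. i < n \<Longrightarrow> j < n \<Longrightarrow> metric M q (e i) (e j) = (if i = j then 1 else 0)"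
    and "v \<in> span (e ` {..<n})"
  shows "v = (\<Sum>i<n. metric M q v (e i) *\<^sub>R e i)"
proof -
  note bil = vf.metric_bilinear[OF assms(1)]
  from assms(3) show ?thesis
  proof (induction rule: span_induct_alt)
    case base
    show ?case by (simp add: bilinear_lzero[OF bil])
  next
    case (step c x y)
    then obtain k where k: "k < n" "x = e k" by auto
    have "(\<Sum>i<n. metric M q (e k) (e i) *\<^sub>R e i) = (\<Sum>i<n. if k = i then e i else 0)"
      using k by (intro sum.cong) (auto simp: orth)
    also have "\<dots> = e k" using k by simp
    finally show ?case
      using step k
      by (simp add: bilinear_ladd[OF bil] bilinear_lmul[OF bil] algebra_simps sum.distrib
          scaleR_sum_right[symmetric] flip: scaleR_scaleR)
  qed
qed

text \<open>Pairing a vanishing linear combination with one of its vectors isolates the coefficient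
  of that vector, so orthonormal vectors are independent; as many of them as the dimension span
  \<open>S\<close>.\<close>

lemma orthonormal_span:
  fixes n :: nat
  assumes "q \<in> pts M"
    and orth: "\<And>i j. i < n \<Longrightarrow> j < n \<Longrightarrow> metric M q (e i) (e j) = (if i = j then 1 else 0)"
    and "e ` {..<n} \<subseteq> S" "subspace S" "dim S = n"
  shows "span (e ` {..<n}) = S"
proof
  note bil = vf.metric_bilinear[OF assms(1)]
  show "span (e ` {..<n}) \<subseteq> S" by (rule span_minimal[OF assms(3,4)])
  have inj: "inj_on e {..<n}"
  proof
    fix i j assume "i \<in> {..<n}" "j \<in> {..<n}" "e i = e j"
    then show "i = j" using orth[of i j] orth[of i i] by (auto split: if_splits)
  qed
  have "independent (e ` {..<n})"
    unfolding independent_explicit_finite_subsets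
  proof (intro allI impI ballI)
    fix A u v assume A: "A \<subseteq> e ` {..<n}" "finite A" "(\<Sum>v\<in>A. u v *\<^sub>R v) = 0" and v: "v \<in> A"
    obtain k where k: "k < n" "v = e k" using A v by auto
    have "0 = metric M q (\<Sum>v\<in>A. u v *\<^sub>R v) v"
      using A by (simp add: bilinear_lzero[OF bil])
    also have "\<dots> = (\<Sum>w\<in>A. u w * metric M q w v)"
      using bilinear_double_sum[OF bil, of u "\<lambda>w. w" A "\<lambda>_. 1" "\<lambda>_. v" "{v}"] by simp
    also have "\<dots> = (\<Sum>w\<in>A. if w = v then u w else 0)"
    proof (rule sum.cong[OF refl])
      fix w assume "w \<in> A"
      then obtain i where "i < n" "w = e i" using A by auto
      then show "u w * metric M q w v = (if w = v then u w else 0)"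
        using k inj by (auto simp: orth inj_on_def)
    qed
    also have "\<dots> = u v" using A v by simp
    finally show "u v = 0" by simp
  qed
  then show "S \<subseteq> span (e ` {..<n})"
    by (intro card_ge_dim_independent) (use assms inj in \<open>auto simp: card_image\<close>)
qed

text \<open>Independence is assumed at \<open>p\<close> only. Each step therefore shrinks the
  neighbourhood to where the residual field \<open>Z\<close> has positive squared length
  \<open>h\<close>, on which \<open>h powr (-1/2)\<close> is smooth. The inclusion of spans holds on
  the whole neighbourhood, so that frames built from horizontal fields stay horizontal.\<close>

lemma gram_schmidt:
  assumes U: "openin (mtop M) U" "p \<in> U"
    and X: "\<And>i. i < n \<Longrightarrow> smooth_vf M U (X i)"
      "\<And>i. i < n \<Longrightarrow> X i p \<notin> span ((\<lambda>j. X j p) ` {..<i})"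
  shows "\<exists>V e. openin (mtop M) V \<and> p \<in> V \<and> V \<subseteq> U \<and> orthonormal_frame M n V e \<and>
    (\<forall>q\<in>V. (\<lambda>i. e i q) ` {..<n} \<subseteq> span ((\<lambda>i. X i q) ` {..<n}))"
  using X
proof (induction n)
  case 0
  show ?case using U by (intro exI[of _ U]) (auto simp: orthonormal_frame_def)
next
  case (Suc n)
  then obtain V e where V: "openin (mtop M) V" "p \<in> V" "V \<subseteq> U" and e: "orthonormal_frame M n V e"
    and sp: "\<And>q. q \<in> V \<Longrightarrow> (\<lambda>i. e i q) ` {..<n} \<subseteq> span ((\<lambda>i. X i q) ` {..<n})"
    by (metis less_Suc_eq)
  have VM: "V \<subseteq> pts M" by (rule openin_subset[OF V(1)])
  have e_smooth: "smooth_vf M V (e i)" if "i < n" for i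
    using e that unfolding orthonormal_frame_def by auto
  have orth: "metric M q (e i q) (e j q) = (if i = j then 1 else 0)" if "q \<in> V" "i < n" "j < n" for q i j
    using e that unfolding orthonormal_frame_def by auto
  have Xn: "smooth_vf M V (X n)" by (rule smooth_along_subset[OF Suc.prems(1) V(3)]) simp
  define Z where "Z q = X n q + (-1) *\<^sub>R (\<Sum>i<n. metric M q (X n q) (e i q) *\<^sub>R e i q)" for q
  define h where "h q = metric M q (Z q) (Z q)" for q
  have Z: "smooth_vf M V Z"
    unfolding Z_def
    by (intro vf.smooth_along_add vf.smooth_along_scaleR[of _ "\<lambda>_. -1"] smooth_fun_const vf.smooth_along_sum
        vf.smooth_along_scaleR vf.smooth_metric_along V vf.M Xn e_smooth) auto
  have h: "smooth_fun M V h"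
    unfolding h_def by (rule vf.smooth_metric_along[OF V(1) Z Z])
  have Ze: "metric M q (Z q) (e j q) = 0" if q: "q \<in> V" "j < n" for q j
  proof -
    have bil: "bilinear (metric M q)" using vf.metric_bilinear VM q by auto
    have "metric M q (\<Sum>i<n. metric M q (X n q) (e i q) *\<^sub>R e i q) (e j q) =
        (\<Sum>i<n. metric M q (X n q) (e i q) * metric M q (e i q) (e j q))"
      using bilinear_double_sum[OF bil, of "\<lambda>i. metric M q (X n q) (e i q)" "\<lambda>i. e i q" "{..<n}"
          "\<lambda>_. 1" "\<lambda>_. e j q" "{j}"] by simp
    also have "\<dots> = (\<Sum>i<n. if i = j then metric M q (X n q) (e i q) else 0)"
      using q by (intro sum.cong) (auto simp: orth)
    also have "\<dots> = metric M q (X n q) (e j q)" using q by simp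
    finally show ?thesis
      unfolding Z_def by (simp add: bilinear_lsub[OF bil])
  qed
  have Zsp: "Z q \<in> span ((\<lambda>i. X i q) ` {..<Suc n})" if "q \<in> V" for q
    unfolding Z_def
  proof (intro span_add span_mul span_sum)
    have "span ((\<lambda>i. X i q) ` {..<n}) \<subseteq> span ((\<lambda>i. X i q) ` {..<Suc n})"
      by (intro span_mono) auto
    then show "e i q \<in> span ((\<lambda>i. X i q) ` {..<Suc n})" if "i \<in> {..<n}" for i
      using sp[OF \<open>q \<in> V\<close>] that by auto
  qed (auto intro: span_base)
  have "Z p \<noteq> 0"
  proof
    assume "Z p = 0"
    then have "X n p = (\<Sum>i<n. metric M p (X n p) (e i p) *\<^sub>R e i p)"
      unfolding Z_def by simp
    also have "\<dots> \<in> span ((\<lambda>j. X j p) ` {..<n})"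
      using sp[OF V(2)] by (intro span_sum span_mul) auto
    finally show False using Suc.prems(2)[of n] by simp
  qed
  then have hp: "h p > 0"
    unfolding h_def using vf.metric_pos VM V(2) by blast
  define V' where "V' = V \<inter> h -` {0<..}"
  have V': "openin (mtop M) V'"
    unfolding V'_def by (rule smooth_fun_open_preimage[OF vf.M V(1) h open_greaterThan])
  have sub: "V' \<subseteq> V" unfolding V'_def by auto
  have hs: "smooth_fun M V' (\<lambda>q. h q powr (-1/2))"
    by (rule smooth_fun_compose_smooth_on[OF vf.M V' smooth_fun_subset[OF h sub] open_greaterThan _
          smooth_on_powr]) (auto simp: V'_def)
  define Z' where "Z' q = (h q powr (-1/2)) *\<^sub>R Z q" for q
  have Z': "smooth_vf M V' Z'"
    unfolding Z'_def by (rule vf.smooth_along_scaleR[OF V' hs smooth_along_subset[OF Z sub]])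
  have one: "metric M q (Z' q) (Z' q) = 1" and zero: "j < n \<Longrightarrow> metric M q (Z' q) (e j q) = 0"
    if q: "q \<in> V'" for q j
  proof -
    have bil: "bilinear (metric M q)" using vf.metric_bilinear VM q sub by auto
    have "h q > 0" using q by (simp add: V'_def)
    then have "h q powr (-1/2) * (h q powr (-1/2) * h q) = h q powr (-1/2 + -1/2 + 1)"
      by (simp only: powr_add) (simp add: mult.assoc)
    then show "metric M q (Z' q) (Z' q) = 1"
      using \<open>h q > 0\<close> by (simp add: Z'_def bilinear_lmul[OF bil] bilinear_rmul[OF bil] flip: h_def)
    show "j < n \<Longrightarrow> metric M q (Z' q) (e j q) = 0"
      using q sub by (auto simp: Z'_def bilinear_lmul[OF bil] Ze)
  qed
  have zero': "metric M q (e j q) (Z' q) = 0" if "q \<in> V'" "j < n" for q j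
    using zero[OF that] vf.metric_sym[of q "e j q" "Z' q"] that sub VM by auto
  have "orthonormal_frame M (Suc n) V' (e(n := Z'))"
    unfolding orthonormal_frame_def
    using Z' smooth_along_subset[OF e_smooth sub] orth sub
    by (auto simp: less_Suc_eq one zero zero' subset_iff)
  moreover have "(\<lambda>i. (e(n := Z')) i q) ` {..<Suc n} \<subseteq> span ((\<lambda>i. X i q) ` {..<Suc n})"
    if q: "q \<in> V'" for q
  proof -
    have "Z' q \<in> span ((\<lambda>i. X i q) ` {..<Suc n})"
      unfolding Z'_def using Zsp q sub by (intro span_mul) auto
    moreover have "span ((\<lambda>i. X i q) ` {..<n}) \<subseteq> span ((\<lambda>i. X i q) ` {..<Suc n})"
      by (intro span_mono) auto
    ultimately have "e i q \<in> span ((\<lambda>i. X i q) ` {..<Suc n})" if "i < n" for i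
      using sp[of q] q sub that by blast
    with \<open>Z' q \<in> _\<close> show ?thesis by (auto simp: less_Suc_eq)
  qed
  moreover have "p \<in> V'" using hp V by (simp add: V'_def)
  ultimately show ?case
    using V' sub V(3) by blast
qed

text \<open>The given fields may be dependent: those whose values at \<open>p\<close> form a basis
  are selected and orthonormalised. Away from \<open>p\<close> the frame is only known to lie in the
  span of the fields; that it generates the desired space is left to a dimension count in each
  application.\<close>

lemma orthonormal_frame_from_fields:
  assumes U: "openin (mtop M) U" "p \<in> U"
    and X: "finite I" "\<And>i. i \<in> I \<Longrightarrow> smooth_vf M U (X i)"
  shows "\<exists>V e. openin (mtop M) V \<and> p \<in> V \<and> V \<subseteq> U \<and>
    orthonormal_frame M (dim ((\<lambda>i. X i p) ` I)) V e \<and>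
    (\<forall>q\<in>V. \<forall>k<dim ((\<lambda>i. X i p) ` I). e k q \<in> span ((\<lambda>i. X i q) ` I))"
proof -
  let ?S = "(\<lambda>i. X i p) ` I" and ?n = "dim ((\<lambda>i. X i p) ` I)"
  obtain B where B: "B \<subseteq> ?S" "independent B" "card B = ?n"
    using basis_exists[of ?S] by metis
  have "finite B" using B(1) X(1) finite_subset by blast
  then obtain b where b: "bij_betw b {0..<?n} B"
    using ex_bij_betw_nat_finite B(3) by metis
  have "\<forall>k<?n. \<exists>i\<in>I. X i p = b k"
  proof (intro allI impI)
    fix k assume "k < ?n"
    then have "b k \<in> B" using b bij_betwE by fastforce
    then have "b k \<in> ?S" using B(1) by blast
    then show "\<exists>i\<in>I. X i p = b k" by (elim imageE) auto
  qed
  then obtain s where s: "\<And>k. k < ?n \<Longrightarrow> s k \<in> I" "\<And>k. k < ?n \<Longrightarrow> X (s k) p = b k"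
    by metis
  \<comment> \<open>Independence of the basis \<open>b\<close> gives the triangular condition on
    which \<open>gram_schmidt\<close> rests.\<close>
  have "X (s k) p \<notin> span ((\<lambda>j. X (s j) p) ` {..<k})" if k: "k < ?n" for k
  proof -
    have "(\<lambda>j. X (s j) p) ` {..<k} = b ` {..<k}" using s k by auto
    moreover have "b ` {..<k} \<subseteq> B - {b k}"
      using b k unfolding bij_betw_def inj_on_def by fastforce
    moreover have "b k \<notin> span (B - {b k})"
      using B(2) b k unfolding dependent_def bij_betw_def by fastforce
    ultimately show ?thesis
      using s(2)[OF k] span_mono[of "b ` {..<k}" "B - {b k}"] by auto
  qed
  with gram_schmidt[OF U, of ?n "\<lambda>k. X (s k)"] X(2) s(1)
  obtain V e where V: "openin (mtop M) V" "p \<in> V" "V \<subseteq> U" "orthonormal_frame M ?n V e"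
    and sp: "\<forall>q\<in>V. (\<lambda>i. e i q) ` {..<?n} \<subseteq> span ((\<lambda>i. X (s i) q) ` {..<?n})"
    by blast
  have "span ((\<lambda>i. X (s i) q) ` {..<?n}) \<subseteq> span ((\<lambda>i. X i q) ` I)" for q
    using s(1) by (intro span_mono) auto
  with V sp show ?thesis by blast
qed

text \<open>The coordinate fields of a chart are orthonormalised; their number is the dimension, so
  the result spans every tangent space near \<open>p\<close>.\<close>

lemma tangent_frame:
  assumes "p \<in> pts M"
  shows "\<exists>V e. openin (mtop M) V \<and> p \<in> V \<and> orthonormal_frame M DIM('n) V e \<and>
    (\<forall>q\<in>V. span ((\<lambda>i. e i q) ` {..<DIM('n)}) = UNIV)"
proof -
  obtain c where c: "c \<in> atlas M" "p \<in> fst c" using chart_at[OF vf.M assms] by blast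
  let ?S = "(\<lambda>b. coord_field M c b p) ` Basis"
  have "v \<in> span ?S" for v
  proof -
    have "(\<Sum>b\<in>Basis. (differential M (snd c) p v \<bullet> b) *\<^sub>R coord_field M c b p) \<in> span ?S"
      by (intro span_sum span_mul span_base imageI)
    then show ?thesis using coord_field_expansion[OF vf.M c, of v] by simp
  qed
  then have "span ?S = UNIV" by blast
  then have dim: "dim ?S = DIM('n)" by (metis dim_span dim_UNIV)
  obtain V e where V: "openin (mtop M) V" "p \<in> V" "orthonormal_frame M DIM('n) V e"
    using orthonormal_frame_from_fields[OF chart_domain(1)[OF vf.M c(1)] c(2), of Basis "coord_field M c"]
      smooth_coord_field[OF vf.M c(1)] unfolding dim by (metis finite_Basis)
  moreover have "span ((\<lambda>i. e i q) ` {..<DIM('n)}) = UNIV" if "q \<in> V" for q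
    using V that openin_subset[OF V(1)]
    by (intro orthonormal_span[of q]) (auto simp: orthonormal_frame_def)
  ultimately show ?thesis by blast
qed

end

section \<open>The pullback connection is torsion free\<close>

locale riemannian_manifold_map = pullback M N F D2 DF + riemannian M
  for M :: "('a, 'n::euclidean_space) riem" and N :: "('b, 'm::euclidean_space) riem" and F D2 DF +
  fixes D1
  assumes D1: "levi_civita M D1"
begin

text \<open>Symmetry of the Christoffel symbols. Coordinate fields commute, and testing the torsion
  on coordinate functions shows that all coordinates of the difference vanish.\<close>

lemma D2_coord_field_sym:
  assumes d: "d \<in> atlas N" "y \<in> fst d"
  shows "D2 y (coord_field N d b y) (coord_field N d c) = D2 y (coord_field N d c y) (coord_field N d b)"
proof -
  note op = chart_domain(1)[OF N d(1)]
  let ?E = "coord_field N d"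
  let ?\<Gamma> = "D2 y (?E b y) (?E c) - D2 y (?E c y) (?E b)"
  have "differential N (snd d) y ?\<Gamma> \<bullet> k = 0" for k
  proof -
    let ?f = "\<lambda>q. snd d q \<bullet> k"
    have f: "smooth_fun N (fst d) ?f"
      by (rule smooth_fun_bounded_linear[OF N op bounded_linear_inner_left smooth_fun_chart[OF N d(1)]])
    have fE: "differential N ?f q v = differential N (snd d) q v \<bullet> k" if "q \<in> fst d" for q v
      by (rule differential_bounded_linear[OF N op that bounded_linear_inner_left
            smooth_fun_chart[OF N d(1)]])
    \<comment> \<open>The derivative of a coordinate function along a coordinate field is the
      constant \<open>a \<bullet> k\<close>, so its second derivative vanishes.\<close>
    have "differential N (\<lambda>q. differential N ?f q (?E a q)) y v = 0" for a v
    proof -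
      have "differential N (\<lambda>q. differential N ?f q (?E a q)) y v = differential N (\<lambda>q. a \<bullet> k) y v"
        by (rule differential_cong[OF N op d(2) smooth_fun_const[OF N op]])
          (simp add: fE chart_coord_field[OF N d(1)])
      then show ?thesis by (simp add: differential_const[OF N op d(2)])
    qed
    then have "differential N ?f y ?\<Gamma> = 0"
      using levi_civita_torsion[OF D2 op smooth_coord_field[OF N d(1), of b]
          smooth_coord_field[OF N d(1), of c] f d(2)] by simp
    then show ?thesis by (simp add: fE[OF d(2)])
  qed
  then have "differential N (snd d) y ?\<Gamma> = 0"
    by (metis euclidean_all_zero_iff)
  then have "differential N (snd d) y ?\<Gamma> = differential N (snd d) y 0"
    using linear_0[OF linear_differential[OF N op d(2) smooth_fun_chart[OF N d(1)]]] by simp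
  from tangent_eqI[OF N d this] show ?thesis by simp
qed

text \<open>In coordinates the derivative of \<open>F_* Y\<close> along \<open>X\<close> consists of
  second derivatives of the components \<open>\<phi>\<close> of \<open>F\<close> and a Christoffel
  term. Exchanging \<open>X\<close> and \<open>Y\<close> cancels the Christoffel terms by symmetry,
  and the second derivatives differ by \<open>[X,Y]\<close> applied to \<open>\<phi>\<close>, which
  is the torsion condition of \<open>D1\<close> tested on \<open>\<phi>\<close>.\<close>

lemma pullback_torsion:
  assumes U: "openin (mtop M) U" and X: "smooth_vf M U X" and Y: "smooth_vf M U Y" and p: "p \<in> U"
  shows "DF p (X p) (\<lambda>q. pushforward M N F q (Y q)) - DF p (Y p) (\<lambda>q. pushforward M N F q (X q)) =
    pushforward M N F p (D1 p (X p) Y - D1 p (Y p) X)"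
proof -
  have UM: "U \<subseteq> pts M" by (rule openin_subset[OF U])
  then have "F p \<in> pts N" using smooth_map_in_pts[OF F] p by blast
  then obtain d where d: "d \<in> atlas N" "F p \<in> fst d" using chart_at[OF N] by blast
  let ?U = "U \<inter> F -` fst d"
  note op = open_preimage_chart[OF U d(1)]
  have pU: "p \<in> ?U" using p d by auto
  define E where "E b = coord_field N d b (F p)" for b
  define \<phi> where "\<phi> b q = (snd d \<circ> F) q \<bullet> b" for b q
  define \<Gamma> where "\<Gamma> c b = D2 (F p) (E c) (coord_field N d b)" for c b
  have sF: "smooth_fun M ?U (snd d \<circ> F)"
    by (rule smooth_fun_subset[OF smooth_map_fun[OF F d(1)]]) (use UM in auto)
  have \<phi>: "smooth_fun M ?U (\<phi> b)" for b
    unfolding \<phi>_def by (rule smooth_fun_bounded_linear[OF M op bounded_linear_inner_left sF])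
  have coeff: "differential N (snd d) (F q) (pushforward M N F q w) \<bullet> b = differential M (\<phi> b) q w"
    if "q \<in> ?U" for q w b
    using differential_bounded_linear[OF M op that bounded_linear_inner_left sF] that UM
    unfolding \<phi>_def by (auto simp: pushforward_chart[OF _ d(1)])
  have push: "pushforward M N F p w = (\<Sum>b\<in>Basis. differential M (\<phi> b) p w *\<^sub>R E b)" for w
    using coord_field_expansion[OF N d, of "pushforward M N F p w"]
    by (simp add: coeff[OF pU] E_def)
  have D2_push: "D2 (F p) (pushforward M N F p w) (coord_field N d b) =
      (\<Sum>c\<in>Basis. differential M (\<phi> c) p w *\<^sub>R \<Gamma> c b)" for w b
  proof -
    have lin: "linear (\<lambda>v. D2 (F p) v (coord_field N d b))"
      by (rule connection_linear[OF levi_civita_connection[OF D2] chart_domain(1)[OF N d(1)]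
            smooth_coord_field[OF N d(1)] d(2)])
    show ?thesis
      unfolding push \<Gamma>_def by (simp add: linear_sum[OF lin] linear_cmul[OF lin])
  qed
  have DF_push: "DF p v (\<lambda>q. pushforward M N F q (Z q)) =
      (\<Sum>b\<in>Basis. differential M (\<lambda>q. differential M (\<phi> b) q (Z q)) p v *\<^sub>R E b)
      + (\<Sum>b\<in>Basis. \<Sum>c\<in>Basis. (differential M (\<phi> b) p (Z p) * differential M (\<phi> c) p v) *\<^sub>R \<Gamma> c b)"
    if Z: "smooth_vf M U Z" for Z v
  proof -
    have "smooth_fun M ?U (\<lambda>q. differential M (\<phi> b) q (Z q))" for b
      by (rule smooth_fun_differential[OF M op \<phi> smooth_along_subset[OF Z Int_lower1]])
    then have "differential M (\<lambda>q. differential N (snd d) (F q) (pushforward M N F q (Z q)) \<bullet> b) p v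
        = differential M (\<lambda>q. differential M (\<phi> b) q (Z q)) p v" for b
      by (rule differential_cong[OF M op pU]) (simp add: coeff)
    then show ?thesis
      using DF_expansion[OF U smooth_along_pushforward[OF U Z] p d refl, of v]
      by (simp add: D2_push coeff[OF pU] sum.distrib scaleR_sum_right push[of v, symmetric] flip: E_def)
  qed
  have sym: "(\<Sum>b\<in>Basis. \<Sum>c\<in>Basis. (y b * x c) *\<^sub>R \<Gamma> c b) = (\<Sum>b\<in>Basis. \<Sum>c\<in>Basis. (x b * y c) *\<^sub>R \<Gamma> c b)"
    for x y :: "'m \<Rightarrow> real"
    by (subst sum.swap)
      (simp add: \<Gamma>_def E_def D2_coord_field_sym[OF d] mult.commute)
  have "pushforward M N F p (D1 p (X p) Y - D1 p (Y p) X) =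
     (\<Sum>b\<in>Basis. differential M (\<lambda>q. differential M (\<phi> b) q (Y q)) p (X p) *\<^sub>R E b) -
     (\<Sum>b\<in>Basis. differential M (\<lambda>q. differential M (\<phi> b) q (X q)) p (Y p) *\<^sub>R E b)"
    unfolding push
    by (simp add: levi_civita_torsion[OF D1 op smooth_along_subset[OF X Int_lower1]
          smooth_along_subset[OF Y Int_lower1] \<phi> pU] algebra_simps sum_subtractf)
  then show ?thesis
    unfolding DF_push[OF X] DF_push[OF Y]
    using sym[of "\<lambda>b. differential M (\<phi> b) p (Y p)" "\<lambda>b. differential M (\<phi> b) p (X p)"] by simp
qed

end

section \<open>Horizontal fields\<close>

locale riemannian_map_data = riemannian_manifold_map M N F D2 DF D1
  for M :: "('a, 'n::euclidean_space) riem" and N :: "('b, 'm::euclidean_space) riem" and F D2 DF D1 +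
  fixes r :: nat
  assumes riem_map: "riemannian_map M N F"
    and rank: "\<And>p. p \<in> pts M \<Longrightarrow> map_rank M N F p = r"
begin

abbreviation push where "push \<equiv> pushforward M N F"
abbreviation H where "H \<equiv> horizontal M N F"

lemma
  assumes "p \<in> pts M"
  shows image_horizontal: "push p ` H p = range (push p)"
    and horizontal_isometry:
      "v \<in> H p \<Longrightarrow> w \<in> H p \<Longrightarrow> metric N (F p) (push p v) (push p w) = metric M p v w"
    and rank_pos: "0 < r"
  using riem_map rank[OF assms] assms unfolding riemannian_map_def by auto

lemma linear_push: "p \<in> pts M \<Longrightarrow> linear (push p)"
  by (rule linear_pushforward[OF M N F])

lemma subspace_horizontal:
  assumes "p \<in> pts M"
  shows "subspace (H p)"
proof -
  note bil = vf.metric_bilinear[OF assms]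
  show ?thesis
    unfolding horizontal_def subspace_def
    by (simp add: bilinear_lzero[OF bil] bilinear_ladd[OF bil] bilinear_lmul[OF bil])
qed

lemma horizontal_lift:
  assumes "p \<in> pts M"
  obtains h where "h \<in> H p" "push p h = push p w"
proof -
  have "push p w \<in> push p ` H p" using image_horizontal[OF assms] by simp
  then show ?thesis using that by (elim imageE) auto
qed

text \<open>One horizontal argument is enough: subtracting from \<open>w\<close> a horizontal vector
  with the same image leaves a vector of the kernel, which is orthogonal to
  \<open>v\<close>.\<close>

lemma horizontal_push:
  assumes "p \<in> pts M" "v \<in> H p"
  shows "metric N (F p) (push p v) (push p w) = metric M p v w"
    and "metric N (F p) (push p w) (push p v) = metric M p w v"
proof -
  obtain h where h: "h \<in> H p" "push p h = push p w" using horizontal_lift[OF assms(1)] .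
  have "push p (w - h) = 0" using h by (simp add: linear_diff[OF linear_push[OF assms(1)]])
  then have "metric M p v (w - h) = 0" using assms(2) unfolding horizontal_def by auto
  then have "metric M p v w = metric M p v h"
    by (simp add: bilinear_rsub[OF vf.metric_bilinear[OF assms(1)]])
  then show 1: "metric N (F p) (push p v) (push p w) = metric M p v w"
    using horizontal_isometry[OF assms(1,2) h(1)] h(2) by simp
  then show "metric N (F p) (push p w) (push p v) = metric M p w v"
    using metric_sym[OF smooth_map_in_pts[OF F assms(1)]] vf.metric_sym[OF assms(1)] by metis
qed

text \<open>\<open>F_*\<close> is injective on horizontal vectors, since a horizontal vector in the
  kernel is orthogonal to itself, and it maps them onto its range.\<close>

lemma dim_horizontal:
  assumes "p \<in> pts M"
  shows "dim (H p) = r"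
proof -
  note sub = subspace_horizontal[OF assms] and lin = linear_push[OF assms]
  have "inj_on (push p) (span (H p))"
    unfolding span_eq_iff[THEN iffD2, OF sub]
  proof
    fix v w assume vw: "v \<in> H p" "w \<in> H p" "push p v = push p w"
    then have "v - w \<in> H p" "push p (v - w) = 0"
      by (auto simp: linear_diff[OF lin] subspace_diff[OF sub])
    then have "metric M p (v - w) (v - w) = 0"
      unfolding horizontal_def by auto
    then show "v = w" using vf.metric_pos[OF assms, of "v - w"] by auto
  qed
  then have "dim (push p ` H p) = dim (H p)" by (rule dim_image_eq[OF lin])
  then show ?thesis
    using rank[OF assms] image_horizontal[OF assms] by (simp add: map_rank_def)
qed

text \<open>For a Riemannian map the adjoint of \<open>F\<^sub>*\<close> composed with \<open>F\<^sub>*\<close> is the orthogonal projection onto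
  \<open>(ker F\<^sub>*)\<^sup>\<bottom>\<close>. Applied to a frame \<open>E\<close> of the tangent bundle it produces smooth horizontal
  fields \<open>h\<close> that span the horizontal spaces.\<close>

lemma horizontal_frame_exists:
  assumes p: "p \<in> pts M"
  shows "\<exists>U e. openin (mtop M) U \<and> p \<in> U \<and> horizontal_frame M N F r U e"
proof -
  obtain V E where V: "openin (mtop M) V" "p \<in> V" and E: "orthonormal_frame M DIM('n) V E"
    and sp: "\<forall>q\<in>V. span ((\<lambda>i. E i q) ` {..<DIM('n)}) = UNIV"
    using tangent_frame[OF p] by blast
  let ?n = "DIM('n)"
  have VM: "V \<subseteq> pts M" by (rule openin_subset[OF V(1)])
  have sE: "smooth_vf M V (E i)" if "i < ?n" for i
    using E that unfolding orthonormal_frame_def by auto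
  have exp: "v = (\<Sum>i<?n. metric M q v (E i q) *\<^sub>R E i q)" if q: "q \<in> V" for q v
    by (rule orthonormal_expansion) (use q VM E sp in \<open>auto simp: orthonormal_frame_def\<close>)
  define h where "h i q = (\<Sum>j<?n. metric N (F q) (push q (E i q)) (push q (E j q)) *\<^sub>R E j q)" for i q
  have sh: "smooth_vf M V (h i)" if "i < ?n" for i
    unfolding h_def
    by (intro vf.smooth_along_sum vf.smooth_along_scaleR smooth_metric_along smooth_along_pushforward V)
      (use that sE in auto)
  have adj: "metric M q (h i q) w = metric N (F q) (push q (E i q)) (push q w)"
    if q: "q \<in> V" for q i w
  proof -
    have qM: "q \<in> pts M" using q VM by auto
    note lin = linear_push[OF qM] and b1 = vf.metric_bilinear[OF qM]
      and b2 = metric_bilinear[OF smooth_map_in_pts[OF F qM]]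
    have "metric M q (h i q) w =
        (\<Sum>j<?n. metric N (F q) (push q (E i q)) (push q (E j q)) * metric M q (E j q) w)"
      unfolding h_def
      using bilinear_double_sum[OF b1, of _ "\<lambda>j. E j q" "{..<?n}" "\<lambda>_. 1" "\<lambda>_. w" "{w}"] by simp
    also have "\<dots> = (\<Sum>j<?n. metric M q w (E j q) * metric N (F q) (push q (E i q)) (push q (E j q)))"
      by (simp add: mult.commute vf.metric_sym[OF qM, of w])
    also have "\<dots> = metric N (F q) (push q (E i q)) (push q (\<Sum>j<?n. metric M q w (E j q) *\<^sub>R E j q))"
      using bilinear_double_sum[OF b2, of "\<lambda>_. 1" "\<lambda>_. push q (E i q)" "{i}"
          "\<lambda>j. metric M q w (E j q)" "\<lambda>j. push q (E j q)" "{..<?n}"]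
      by (simp add: linear_sum[OF lin] linear_cmul[OF lin])
    finally show ?thesis by (simp flip: exp[OF q])
  qed
  have hH: "h i q \<in> H q" if q: "q \<in> V" for q i
  proof -
    have "F q \<in> pts N" using q VM smooth_map_in_pts[OF F] by blast
    from bilinear_rzero[OF metric_bilinear[OF this]] show ?thesis
      unfolding horizontal_def by (simp add: adj[OF q])
  qed
  let ?S = "(\<lambda>i. h i p) ` {..<?n}"
  have "H p \<subseteq> span ?S"
  proof
    fix v assume v: "v \<in> H p"
    note lin = linear_push[OF p] and b1 = vf.metric_bilinear[OF p]
      and b2 = metric_bilinear[OF smooth_map_in_pts[OF F p]]
    \<comment> \<open>This is the image of \<open>v\<close> under \<open>F_*\<close> followed by its
      adjoint. It pairs with every vector as \<open>v\<close> does, hence equals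
      \<open>v\<close>.\<close>
    let ?u = "\<Sum>i<?n. metric M p v (E i p) *\<^sub>R h i p"
    have uH: "?u \<in> H p"
      by (intro subspace_sum subspace_mul subspace_horizontal p hH V)
    have "metric M p ?u w = metric N (F p) (push p v) (push p w)" for w
    proof -
      have "metric M p ?u w = (\<Sum>i<?n. metric M p v (E i p) * metric N (F p) (push p (E i p)) (push p w))"
        using bilinear_double_sum[OF b1, of "\<lambda>i. metric M p v (E i p)" "\<lambda>i. h i p" "{..<?n}"
            "\<lambda>_. 1" "\<lambda>_. w" "{w}"] by (simp add: adj[OF V(2)])
      also have "\<dots> = metric N (F p) (push p (\<Sum>i<?n. metric M p v (E i p) *\<^sub>R E i p)) (push p w)"
        using bilinear_double_sum[OF b2, of "\<lambda>i. metric M p v (E i p)" "\<lambda>i. push p (E i p)" "{..<?n}"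
            "\<lambda>_. 1" "\<lambda>_. push p w" "{w}"]
        by (simp add: linear_sum[OF lin] linear_cmul[OF lin])
      finally show ?thesis by (simp flip: exp[OF V(2)])
    qed
    then have "metric M p (?u - v) (?u - v) = 0"
      by (simp add: bilinear_lsub[OF b1] horizontal_push[OF p v])
    then have "?u = v" using vf.metric_pos[OF p, of "?u - v"] by auto
    moreover have "?u \<in> span ?S"
      by (intro span_sum span_mul span_base imageI)
    ultimately show "v \<in> span ?S" by simp
  qed
  moreover have "span ?S \<subseteq> H p"
    using hH[OF V(2)] by (intro span_minimal subspace_horizontal p) auto
  ultimately have "dim ?S = r"
    using dim_horizontal[OF p] by (metis dim_span subset_antisym)
  then obtain U e where U: "openin (mtop M) U" "p \<in> U" "U \<subseteq> V" and e: "orthonormal_frame M r U e"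
    and esp: "\<forall>q\<in>U. \<forall>k<r. e k q \<in> span ((\<lambda>i. h i q) ` {..<?n})"
    using orthonormal_frame_from_fields[OF V, of "{..<?n}" h] sh by auto
  \<comment> \<open>Constant rank is decisive: the horizontal spaces near \<open>p\<close> also have
    dimension \<open>r\<close>, so an orthonormal frame with values in them spans them.\<close>
  have "span ((\<lambda>i. e i q) ` {..<r}) = H q" if q: "q \<in> U" for q
  proof (rule orthonormal_span)
    show qM: "q \<in> pts M" using q U VM by auto
    show "subspace (H q)" "dim (H q) = r"
      using subspace_horizontal[OF qM] dim_horizontal[OF qM] by auto
    have "span ((\<lambda>i. h i q) ` {..<?n}) \<subseteq> H q"
      using hH[of q] q U by (intro span_minimal subspace_horizontal qM) auto
    then show "(\<lambda>i. e i q) ` {..<r} \<subseteq> H q" using esp q by auto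
  qed (use e q in \<open>auto simp: orthonormal_frame_def\<close>)
  then have "horizontal_frame M N F r U e"
    using e unfolding horizontal_frame_def orthonormal_frame_def by auto
  with U show ?thesis by blast
qed

lemma horizontal_frameD:
  assumes "horizontal_frame M N F r U e"
  shows "i < r \<Longrightarrow> smooth_vf M U (e i)"
    and "q \<in> U \<Longrightarrow> i < r \<Longrightarrow> e i q \<in> H q"
    and "q \<in> U \<Longrightarrow> i < r \<Longrightarrow> j < r \<Longrightarrow> metric M q (e i q) (e j q) = (if i = j then 1 else 0)"
    and "q \<in> U \<Longrightarrow> q \<in> pts M \<Longrightarrow> v \<in> H q \<Longrightarrow> v = (\<Sum>i<r. metric M q v (e i q) *\<^sub>R e i q)"
proof -
  note e = assms[unfolded horizontal_frame_def]
  show "i < r \<Longrightarrow> smooth_vf M U (e i)" using e by auto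
  show "e i q \<in> H q" if "q \<in> U" "i < r"
  proof -
    have "e i q \<in> span ((\<lambda>i. e i q) ` {..<r})" using that by (intro span_base) auto
    then show ?thesis using e that by auto
  qed
  show orth: "metric M q (e i q) (e j q) = (if i = j then 1 else 0)"
    if "q \<in> U" "i < r" "j < r" for i j
    using e that by auto
  show "v = (\<Sum>i<r. metric M q v (e i q) *\<^sub>R e i q)" if "q \<in> U" "q \<in> pts M" "v \<in> H q"
    by (rule orthonormal_expansion) (use that orth e in auto)
qed

lemma horizontal_frame_subset:
  "horizontal_frame M N F r U e \<Longrightarrow> V \<subseteq> U \<Longrightarrow> horizontal_frame M N F r V e"
  unfolding horizontal_frame_def by (auto intro: smooth_along_subset)

text \<open>Bridges pointwise arguments and hypotheses on global fields: a local horizontal field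
  through \<open>v\<close> is cut off by a bump function and extended by zero, which is again
  horizontal.\<close>

lemma horizontal_extension:
  assumes p: "p \<in> pts M" and v: "v \<in> H p"
  obtains X where "X \<in> horizontal_fields M N F" "X p = v"
proof -
  obtain U e where U: "openin (mtop M) U" "p \<in> U" and e: "horizontal_frame M N F r U e"
    using horizontal_frame_exists[OF p] by blast
  obtain \<eta> :: "_ \<Rightarrow> real" and W where \<eta>: "smooth_fun M (pts M) \<eta>" "\<eta> p = 1" and W: "openin (mtop M) W"
    "U \<union> W = pts M" "\<And>q. q \<in> W \<Longrightarrow> \<eta> q = 0"
    by (rule manifold_bump[OF M U]) blast
  \<comment> \<open>The coefficients are frozen at their values at \<open>p\<close>; only the frame
    and the cut-off vary with \<open>q\<close>.\<close>
  define Y where "Y q = \<eta> q *\<^sub>R (\<Sum>i<r. metric M p v (e i p) *\<^sub>R e i q)" for q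
  define X where "X q = (if q \<in> U then Y q else 0)" for q
  have "smooth_vf M U Y"
    unfolding Y_def
    by (intro vf.smooth_along_scaleR vf.smooth_along_sum smooth_fun_const U M
        horizontal_frameD(1)[OF e] smooth_fun_subset[OF \<eta>(1)]) (use W in auto)
  then have "smooth_vf M U X" by (rule vf.smooth_along_cong[OF U(1)]) (simp add: X_def)
  moreover have "smooth_vf M W X"
    by (rule vf.smooth_along_cong[OF W(1) vf.smooth_along_zero[OF W(1)]]) (simp add: X_def Y_def W(3))
  ultimately have "smooth_vf M (pts M) X"
    using U W by (intro vf.smooth_along_local) blast
  moreover have "X q \<in> H q" if q: "q \<in> pts M" for q
    unfolding X_def Y_def
    using horizontal_frameD(2)[OF e]
    by (auto intro!: subspace_mul subspace_sum subspace_horizontal q subspace_0)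
  moreover have "X p = v"
    using horizontal_frameD(4)[OF e U(2) p v] by (simp add: X_def Y_def U \<eta>)
  ultimately show ?thesis using that unfolding horizontal_fields_def by auto
qed

end

section \<open>The second fundamental form\<close>

context riemannian_map_data
begin

abbreviation S where "S \<equiv> second_form M N F D1 DF"
abbreviation HF where "HF U X \<equiv> smooth_vf M U X \<and> (\<forall>q\<in>U. X q \<in> H q)"

lemma second_form_sym:
  assumes "openin (mtop M) U" "smooth_vf M U X" "smooth_vf M U Y" "p \<in> U"
  shows "S X Y p = S Y X p"
proof -
  have "p \<in> pts M" using openin_subset[OF assms(1)] assms(4) by blast
  then show ?thesis
    using pullback_torsion[OF assms] linear_diff[OF linear_push, of p]
    unfolding second_form_def by (simp add: algebra_simps)
qed

text \<open>Only the value of \<open>X\<close> at \<open>p\<close> enters, which is tensoriality in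
  the first argument; \<open>second_form_sym\<close> carries it over to the second.\<close>

lemma second_form_sum_left:
  assumes "openin (mtop M) U" "smooth_vf M U Y" "p \<in> U" "X p = (\<Sum>i\<in>I. c i *\<^sub>R e i p)"
  shows "S X Y p = (\<Sum>i\<in>I. c i *\<^sub>R S (e i) Y p)"
proof -
  have p: "p \<in> pts M" using openin_subset[OF assms(1)] assms(3) by blast
  have l1: "linear (\<lambda>v. DF p v (\<lambda>q. push q (Y q)))"
    by (rule connection_linear[OF DF_connection assms(1) smooth_along_pushforward[OF assms(1,2)] assms(3)])
  have l2: "linear (\<lambda>v. D1 p v Y)"
    by (rule connection_linear[OF levi_civita_connection[OF D1] assms(1-3)])
  note l3 = linear_push[OF p]
  show ?thesis
    unfolding second_form_def assms(4)
    by (simp add: linear_sum[OF l1] linear_cmul[OF l1] linear_sum[OF l2] linear_cmul[OF l2]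
        linear_sum[OF l3] linear_cmul[OF l3] sum_subtractf algebra_simps)
qed

text \<open>\<open>g\<^sub>2((\<nabla>F\<^sub>*)(X,Y), F\<^sub>*Z)\<close> is symmetric in \<open>X, Y\<close> because both connections are torsion free and
  skew in \<open>Y, Z\<close> because both are metric and \<open>F\<^sub>*\<close> is isometric on horizontal vectors; such a
  trilinear expression vanishes.\<close>

lemma second_form_normal:
  assumes U: "openin (mtop M) U" "p \<in> U" and X: "HF U X" and Y: "HF U Y"
  shows "metric N (F p) (S X Y p) (push p w) = 0"
proof -
  define T where "T X Y Z = metric N (F p) (S X Y p) (push p (Z p))" for X Y Z
  have UM: "U \<subseteq> pts M" by (rule openin_subset[OF U(1)])
  then have p: "p \<in> pts M" using U(2) by blast
  note bil = metric_bilinear[OF smooth_map_in_pts[OF F p]]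
    and sym = metric_sym[OF smooth_map_in_pts[OF F p]]
  have skew: "T X Y Z = - T X Z Y" if "HF U X" "HF U Y" "HF U Z" for X Y Z
  proof -
    let ?FY = "\<lambda>q. push q (Y q)" and ?FZ = "\<lambda>q. push q (Z q)"
    have "differential M (\<lambda>q. metric N (F q) (?FY q) (?FZ q)) p (X p) =
        differential M (\<lambda>q. metric M q (Y q) (Z q)) p (X p)"
      by (rule differential_cong[OF M U vf.smooth_metric_along[OF U(1)]])
        (use that UM in \<open>auto simp: horizontal_isometry\<close>)
    also have "\<dots> = metric M p (D1 p (X p) Y) (Z p) + metric M p (Y p) (D1 p (X p) Z)"
      using that by (intro levi_civita_metric[OF D1 U(1) _ _ U(2)]) auto
    also have "\<dots> = metric N (F p) (push p (D1 p (X p) Y)) (?FZ p)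
        + metric N (F p) (?FY p) (push p (D1 p (X p) Z))"
      using that U(2) by (simp add: horizontal_push[OF p])
    finally have "metric N (F p) (DF p (X p) ?FY) (?FZ p) + metric N (F p) (?FY p) (DF p (X p) ?FZ) =
        metric N (F p) (push p (D1 p (X p) Y)) (?FZ p) + metric N (F p) (?FY p) (push p (D1 p (X p) Z))"
      using pullback_metric[OF U(1) smooth_along_pushforward[OF U(1)] smooth_along_pushforward[OF U(1)]
          U(2), of Y Z "X p"] that by simp
    then show ?thesis
      unfolding T_def second_form_def
      by (simp add: bilinear_lsub[OF bil] sym[of "?FY p"])
  qed
  have symT: "T X Y Z = T Y X Z" if "HF U X" "HF U Y" for X Y Z
    using second_form_sym[OF U(1) _ _ U(2)] that unfolding T_def by simp
  \<comment> \<open>Alternating the two rules gives \<open>T X Y Z = - T X Z Y = - T Z X Y = T Z Y X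
    = T Y Z X = - T Y X Z = - T X Y Z\<close>.\<close>
  have T0: "T X Y Z = 0" if "HF U X" "HF U Y" "HF U Z" for X Y Z
    using skew[of X Y Z] symT[of X Z Y] skew[of Z X Y] symT[of Z Y X] skew[of Y Z X] symT[of Y X Z] that
    by linarith
  obtain h where h: "h \<in> H p" "push p h = push p w" using horizontal_lift[OF p] .
  obtain Z where "Z \<in> horizontal_fields M N F" "Z p = h" using horizontal_extension[OF p h(1)] .
  then have "HF U Z" "Z p = h"
    using UM unfolding horizontal_fields_def by (auto elim: smooth_along_subset)
  with T0[OF X Y] h show ?thesis unfolding T_def by metis
qed

lemma second_form_smooth:
  assumes U: "openin (mtop M) U" and X: "smooth_vf M U X" and Y: "smooth_vf M U Y"
  shows "smooth_along M N F U (S X Y)"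
\<comment> \<open>Localising merely supplies a point \<open>q\<close>, which
  \<open>connection_smooth\<close> takes as an argument; the neighbourhood is \<open>U\<close>
  itself.\<close>
proof (rule smooth_along_local)
  fix q assume q: "q \<in> U"
  have "smooth_along M N F U (\<lambda>q. DF q (X q) (\<lambda>q. push q (Y q)) + (-1) *\<^sub>R push q (D1 q (X q) Y))"
    by (intro smooth_along_add smooth_along_scaleR smooth_fun_const M U smooth_along_pushforward
        connection_smooth[OF DF_connection U _ q] connection_smooth[OF levi_civita_connection[OF D1] U _ q]
        X Y)
  then have "smooth_along M N F U (S X Y)"
    by (rule smooth_along_cong[OF U]) (simp add: second_form_def)
  with U q show "\<exists>U. openin (mtop M) U \<and> q \<in> U \<and> smooth_along M N F U (S X Y)" by blast
qed

text \<open>At \<open>p\<close> the two frames differ by an orthogonal matrix \<open>a\<close>, and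
  the trace of a symmetric bilinear form is invariant under such a change.\<close>

lemma frame_trace_unique:
  assumes p: "p \<in> pts M" and U: "openin (mtop M) U" "p \<in> U" "horizontal_frame M N F r U e"
    and V: "openin (mtop M) V" "p \<in> V" "horizontal_frame M N F r V e'"
  shows "(\<Sum>i<r. S (e' i) (e' i) p) = (\<Sum>i<r. S (e i) (e i) p)"
proof -
  let ?W = "U \<inter> V"
  have op: "openin (mtop M) ?W" and pW: "p \<in> ?W" using U V by auto
  have e: "horizontal_frame M N F r ?W e" and e': "horizontal_frame M N F r ?W e'"
    by (rule horizontal_frame_subset[OF U(3)] horizontal_frame_subset[OF V(3)]; simp)+
  note eD = horizontal_frameD[OF e] and eD' = horizontal_frameD[OF e']
  note bil = vf.metric_bilinear[OF p]
  define a where "a i j = metric M p (e' i p) (e j p)" for i j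
  have e'_eq: "e' i p = (\<Sum>j<r. a i j *\<^sub>R e j p)" if "i < r" for i
    unfolding a_def using eD(4)[OF pW p eD'(2)[OF pW that]] .
  \<comment> \<open>Expanding \<open>e j\<close> in the other frame and pairing it with
    \<open>e k\<close> shows that the columns of \<open>a\<close> are orthonormal.\<close>
  have orth: "(\<Sum>i<r. a i j * a i k) = (if j = k then 1 else 0)" if "j < r" "k < r" for j k
  proof -
    have "e j p = (\<Sum>i<r. a i j *\<^sub>R e' i p)"
      unfolding a_def vf.metric_sym[OF p, of _ "e j p"] using eD'(4)[OF pW p eD(2)[OF pW that(1)]] .
    then have "metric M p (e j p) (e k p) = metric M p (\<Sum>i<r. a i j *\<^sub>R e' i p) (e k p)" by simp
    also have "\<dots> = (\<Sum>i<r. a i j * a i k)"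
      using bilinear_double_sum[OF bil, of "\<lambda>i. a i j" "\<lambda>i. e' i p" "{..<r}" "\<lambda>_. 1" "\<lambda>_. e k p" "{k}"]
      by (simp add: a_def)
    finally show ?thesis using eD(3)[OF pW that] by simp
  qed
  have exp: "S (e' i) (e' i) p = (\<Sum>j<r. \<Sum>k<r. (a i j * a i k) *\<^sub>R S (e j) (e k) p)" if i: "i < r" for i
  proof -
    have "S (e j) (e' i) p = (\<Sum>k<r. a i k *\<^sub>R S (e j) (e k) p)" if j: "j < r" for j
    proof -
      \<comment> \<open>Linearity is available in the first argument, so the second is expanded by
        exchanging the two, expanding, and exchanging back.\<close>
      have "S (e j) (e' i) p = S (e' i) (e j) p"
        by (rule second_form_sym[OF op eD(1)[OF j] eD'(1)[OF i] pW])
      also have "\<dots> = (\<Sum>k<r. a i k *\<^sub>R S (e k) (e j) p)"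
        by (rule second_form_sum_left[OF op eD(1)[OF j] pW,
              where X = "e' i" and c = "a i" and e = e and I = "{..<r}", OF e'_eq[OF i]])
      also have "\<dots> = (\<Sum>k<r. a i k *\<^sub>R S (e j) (e k) p)"
        using j by (intro sum.cong) (auto simp: second_form_sym[OF op eD(1) eD(1)[OF j] pW])
      finally show ?thesis .
    qed
    then show ?thesis
      unfolding second_form_sum_left[OF op eD'(1)[OF i] pW,
          where X = "e' i" and c = "a i" and e = e and I = "{..<r}", OF e'_eq[OF i]]
      by (simp add: scaleR_sum_right)
  qed
  have "(\<Sum>i<r. S (e' i) (e' i) p) = (\<Sum>i<r. \<Sum>j<r. \<Sum>k<r. (a i j * a i k) *\<^sub>R S (e j) (e k) p)"
    by (simp add: exp)
  also have "\<dots> = (\<Sum>j<r. \<Sum>i<r. \<Sum>k<r. (a i j * a i k) *\<^sub>R S (e j) (e k) p)"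
    by (rule sum.swap)
  also have "\<dots> = (\<Sum>j<r. \<Sum>k<r. \<Sum>i<r. (a i j * a i k) *\<^sub>R S (e j) (e k) p)"
    by (rule sum.cong[OF refl]) (rule sum.swap)
  also have "\<dots> = (\<Sum>j<r. \<Sum>k<r. if j = k then S (e j) (e k) p else 0)"
    by (intro sum.cong refl) (simp add: orth flip: scaleR_sum_left)
  also have "\<dots> = (\<Sum>j<r. S (e j) (e j) p)" by simp
  finally show ?thesis .
qed

section \<open>The mean curvature field as a smooth normal section\<close>

abbreviation H2 where "H2 \<equiv> mean_curvature M N F D1 DF r"

text \<open>Replaces the frame chosen separately at every point by one frame on all of
  \<open>U\<close>; only then can smoothness of \<open>H2\<close> be read off.\<close>

lemma mean_curvature_frame:
  assumes U: "openin (mtop M) U" "horizontal_frame M N F r U e" "p \<in> U"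
  shows "H2 p = (1 / real r) *\<^sub>R (\<Sum>i<r. S (e i) (e i) p)"
proof -
  have p: "p \<in> pts M" using openin_subset[OF U(1)] U(3) by blast
  define e' where "e' = (SOME e. \<exists>U. openin (mtop M) U \<and> p \<in> U \<and> horizontal_frame M N F r U e)"
  have "\<exists>e U. openin (mtop M) U \<and> p \<in> U \<and> horizontal_frame M N F r U e"
    using U by blast
  from someI_ex[OF this] obtain V where "openin (mtop M) V" "p \<in> V" "horizontal_frame M N F r V e'"
    unfolding e'_def by blast
  from frame_trace_unique[OF p U(1,3,2) this] show ?thesis
    unfolding mean_curvature_def e'_def[symmetric] Let_def by simp
qed

lemma mean_curvature_smooth: "smooth_along M N F (pts M) H2"
proof (rule smooth_along_local)
  fix p assume p: "p \<in> pts M"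
  then obtain U e where U: "openin (mtop M) U" "p \<in> U" and e: "horizontal_frame M N F r U e"
    using horizontal_frame_exists by blast
  have "smooth_along M N F U (\<lambda>q. (1 / real r) *\<^sub>R (\<Sum>i<r. S (e i) (e i) q))"
    by (intro smooth_along_scaleR smooth_fun_const M U smooth_along_sum second_form_smooth
        horizontal_frameD(1)[OF e]) auto
  then have "smooth_along M N F U H2"
    by (rule smooth_along_cong[OF U(1)]) (simp add: mean_curvature_frame[OF U(1) e])
  with U show "\<exists>U. openin (mtop M) U \<and> p \<in> U \<and> smooth_along M N F U H2" by blast
qed

lemma mean_curvature_normal:
  assumes p: "p \<in> pts M"
  shows "metric N (F p) (push p w) (H2 p) = 0"
proof -
  obtain U e where U: "openin (mtop M) U" "p \<in> U" and e: "horizontal_frame M N F r U e"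
    using horizontal_frame_exists[OF p] by blast
  note bil = metric_bilinear[OF smooth_map_in_pts[OF F p]]
    and sym = metric_sym[OF smooth_map_in_pts[OF F p]]
  have "metric N (F p) (H2 p) (push p w) = (1 / real r) * (\<Sum>i<r. metric N (F p) (S (e i) (e i) p) (push p w))"
    unfolding mean_curvature_frame[OF U(1) e U(2)]
    using bilinear_double_sum[OF bil, of "\<lambda>_. 1" "\<lambda>i. S (e i) (e i) p" "{..<r}" "\<lambda>_. 1"
        "\<lambda>_. push p w" "{w}"]
    by (simp add: bilinear_lmul[OF bil])
  also have "\<dots> = 0"
    using second_form_normal[OF U] horizontal_frameD(1,2)[OF e] by simp
  finally show ?thesis by (simp add: sym[of "push p w"])
qed

text \<open>The term \<open>F_*\<close> of \<open>D1 p (X p) Y\<close> drops out because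
  \<open>H2\<close> is normal. \<open>Y\<close> is local so that the fields of a frame can be
  inserted as well as global ones.\<close>

lemma second_form_mean_curvature:
  assumes U: "openin (mtop M) U" "p \<in> U" and Y: "smooth_vf M U Y"
  shows "metric N (F p) (S X Y p) (H2 p) = - metric N (F p) (DF p (X p) H2) (push p (Y p))"
proof -
  have UM: "U \<subseteq> pts M" by (rule openin_subset[OF U(1)])
  then have p: "p \<in> pts M" using U(2) by blast
  note bil = metric_bilinear[OF smooth_map_in_pts[OF F p]]
    and sym = metric_sym[OF smooth_map_in_pts[OF F p]]
  let ?FY = "\<lambda>q. push q (Y q)"
  have "differential M (\<lambda>q. metric N (F q) (?FY q) (H2 q)) p (X p) = differential M (\<lambda>q. 0::real) p (X p)"
    by (rule differential_cong[OF M U smooth_fun_const[OF M U(1)]])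
      (use UM in \<open>auto simp: mean_curvature_normal\<close>)
  also have "\<dots> = 0" by (rule differential_const[OF M U])
  finally have "metric N (F p) (DF p (X p) ?FY) (H2 p) + metric N (F p) (?FY p) (DF p (X p) H2) = 0"
    using pullback_metric[OF U(1) smooth_along_pushforward[OF U(1) Y]
        smooth_along_subset[OF mean_curvature_smooth UM] U(2), of "X p"] by simp
  then show ?thesis
    unfolding second_form_def
    by (simp add: bilinear_lsub[OF bil] mean_curvature_normal[OF p] sym[of "?FY p"])
qed

text \<open>Makes the definite description in \<open>range_component\<close> usable. Existence comes
  from an orthonormal horizontal frame; uniqueness holds because the difference of two candidates
  lies in the range and is orthogonal to it.\<close>

lemma range_component_props:
  assumes p: "p \<in> pts M"
  shows "\<And>s. metric N (F p) (range_component M N F p w) (push p s) = metric N (F p) w (push p s)"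
    and "\<And>v. (\<And>s. metric N (F p) (push p v) (push p s) = metric N (F p) w (push p s)) \<Longrightarrow>
      range_component M N F p w = push p v"
proof -
  note lin = linear_push[OF p] and bil = metric_bilinear[OF smooth_map_in_pts[OF F p]]
    and b1 = vf.metric_bilinear[OF p]
  let ?P = "\<lambda>u. u \<in> range (push p) \<and> (\<forall>s\<in>range (push p). metric N (F p) (w - u) s = 0)"
  have P: "?P (push p v)" if "\<And>s. metric N (F p) (push p v) (push p s) = metric N (F p) w (push p s)" for v
    using that by (auto simp: bilinear_lsub[OF bil])
  have unique: "u = u'" if uu: "?P u" "?P u'" for u u'
  proof -
    obtain v v' where v: "u = push p v" "u' = push p v'" using uu by blast
    have "metric N (F p) (w - u) (push p (v - v')) = 0" "metric N (F p) (w - u') (push p (v - v')) = 0"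
      using that by auto
    then have "metric N (F p) (u - u') (u - u') = 0"
      unfolding v by (simp add: linear_diff[OF lin] bilinear_lsub[OF bil])
    then show ?thesis using metric_pos[OF smooth_map_in_pts[OF F p], of "u - u'"] by auto
  qed
  obtain U e where U: "openin (mtop M) U" "p \<in> U" and e: "horizontal_frame M N F r U e"
    using horizontal_frame_exists[OF p] by blast
  \<comment> \<open>The vectors \<open>push p (e i p)\<close> form an orthonormal basis of the
    range, so the image of \<open>?v\<close> is the orthogonal projection of
    \<open>w\<close>.\<close>
  let ?v = "\<Sum>i<r. metric N (F p) w (push p (e i p)) *\<^sub>R e i p"
  have vH: "?v \<in> H p"
    by (intro subspace_sum subspace_mul subspace_horizontal p horizontal_frameD(2)[OF e U(2)]) auto
  have ex: "metric N (F p) (push p ?v) (push p s) = metric N (F p) w (push p s)" for s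
  proof -
    obtain h where h: "h \<in> H p" "push p h = push p s" using horizontal_lift[OF p] .
    have "metric N (F p) (push p ?v) (push p h) = metric M p ?v h"
      by (rule horizontal_isometry[OF p vH h(1)])
    also have "\<dots> = (\<Sum>i<r. metric M p h (e i p) * metric N (F p) w (push p (e i p)))"
      using bilinear_double_sum[OF b1, of "\<lambda>i. metric N (F p) w (push p (e i p))" "\<lambda>i. e i p" "{..<r}"
          "\<lambda>_. 1" "\<lambda>_. h" "{h}"] by (simp add: vf.metric_sym[OF p, of _ h] mult.commute)
    also have "\<dots> = metric N (F p) w (push p (\<Sum>i<r. metric M p h (e i p) *\<^sub>R e i p))"
      using bilinear_double_sum[OF bil, of "\<lambda>_. 1" "\<lambda>_. w" "{w}" "\<lambda>i. metric M p h (e i p)"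
          "\<lambda>i. push p (e i p)" "{..<r}"] by (simp add: linear_sum[OF lin] linear_cmul[OF lin])
    finally show ?thesis
      using h(2) by (simp flip: horizontal_frameD(4)[OF e U(2) p h(1)])
  qed
  have "?P (range_component M N F p w)"
    unfolding range_component_def by (rule theI[of ?P, OF P[OF ex]]) (rule unique, assumption, rule P[OF ex])
  then show "metric N (F p) (range_component M N F p w) (push p s) = metric N (F p) w (push p s)" for s
    by (simp add: bilinear_lsub[OF bil])
  show "range_component M N F p w = push p v"
    if "\<And>s. metric N (F p) (push p v) (push p s) = metric N (F p) w (push p s)" for v
    unfolding range_component_def by (rule the_equality[of ?P, OF P[OF that]]) (rule unique, assumption, rule P[OF that])
qed

section \<open>Pseudo-umbilicity compared with the second fundamental form\<close>

lemma pseudo_umbilical_imp: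
  assumes l: "\<And>X p. X \<in> horizontal_fields M N F \<Longrightarrow> p \<in> pts M \<Longrightarrow>
      shape_operator M N F DF H2 X p = l p *\<^sub>R push p (X p)"
    and X: "X \<in> horizontal_fields M N F" and Y: "Y \<in> horizontal_fields M N F" and p: "p \<in> pts M"
  shows "metric N (F p) (S X Y p) (H2 p) = metric M p (X p) (Y p) * metric N (F p) (H2 p) (H2 p)"
proof -
  note bil = metric_bilinear[OF smooth_map_in_pts[OF F p]]
  \<comment> \<open>The hypothesis speaks of global fields, so \<open>v\<close> is extended to one;
    the result depends on \<open>v\<close> alone and hence applies to values of local
    frames.\<close>
  have DH2: "- metric N (F p) (DF p v H2) (push p w) = l p * metric M p v w" if v: "v \<in> H p" for v w
  proof -
    obtain Z where Z: "Z \<in> horizontal_fields M N F" "Z p = v" using horizontal_extension[OF p v] .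
    have "range_component M N F p (DF p v H2) = - l p *\<^sub>R push p v"
      using l[OF Z(1) p] Z(2) by (simp add: shape_operator_def neg_equal_iff_equal minus_equation_iff)
    then show ?thesis
      using range_component_props(1)[OF p, of "DF p v H2" w]
      by (simp add: bilinear_lneg[OF bil] bilinear_lmul[OF bil] horizontal_push[OF p v])
  qed
  have SH: "metric N (F p) (S X Y p) (H2 p) = l p * metric M p (X p) (Y p)"
    if "openin (mtop M) U" "p \<in> U" "smooth_vf M U Y" "X p \<in> H p" for U X Y
    using second_form_mean_curvature[OF that(1-3)] DH2[OF that(4)] by simp
  obtain U e where U: "openin (mtop M) U" "p \<in> U" and e: "horizontal_frame M N F r U e"
    using horizontal_frame_exists[OF p] by blast
  have "metric N (F p) (H2 p) (H2 p) = (1 / real r) * (\<Sum>i<r. metric N (F p) (S (e i) (e i) p) (H2 p))"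
    unfolding mean_curvature_frame[OF U(1) e U(2)]
    using bilinear_double_sum[OF bil, of "\<lambda>_. 1" "\<lambda>i. S (e i) (e i) p" "{..<r}" "\<lambda>_. 1"
        "\<lambda>_. H2 p" "{0}"] mean_curvature_frame[OF U(1) e U(2)]
    by (simp add: bilinear_lmul[OF bil])
  \<comment> \<open>Each \<open>e i p\<close> is a unit vector, so every term of the trace equals
    \<open>l p\<close>; positive rank then cancels the normalising factor.\<close>
  also have "\<dots> = (1 / real r) * (\<Sum>i<r. l p)"
    using horizontal_frameD[OF e] U by (simp add: SH[OF U])
  also have "\<dots> = l p" using rank_pos[OF p] by simp
  finally have "metric N (F p) (H2 p) (H2 p) = l p" .
  with SH[OF openin_topspace p] X Y p show ?thesis
    unfolding horizontal_fields_def by simp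
qed

lemma pseudo_umbilicalI:
  assumes "\<And>X Y p. X \<in> horizontal_fields M N F \<Longrightarrow> Y \<in> horizontal_fields M N F \<Longrightarrow> p \<in> pts M \<Longrightarrow>
    metric N (F p) (S X Y p) (H2 p) = metric M p (X p) (Y p) * metric N (F p) (H2 p) (H2 p)"
  shows "pseudo_umbilical M N F D1 DF r"
proof -
  \<comment> \<open>The only possible factor, as the trace in \<open>pseudo_umbilical_imp\<close>
    shows; it is smooth because \<open>H2\<close> is.\<close>
  let ?l = "\<lambda>p. metric N (F p) (H2 p) (H2 p)"
  have "shape_operator M N F DF H2 X p = ?l p *\<^sub>R push p (X p)"
    if X: "X \<in> horizontal_fields M N F" and p: "p \<in> pts M" for X p
  proof -
    note bil = metric_bilinear[OF smooth_map_in_pts[OF F p]] and lin = linear_push[OF p]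
    have XH: "X p \<in> H p" using X p unfolding horizontal_fields_def by simp
    have "range_component M N F p (DF p (X p) H2) = push p (- ?l p *\<^sub>R X p)"
    proof (rule range_component_props(2)[OF p])
      fix s
      \<comment> \<open>A test vector of the range is the image of a horizontal \<open>h\<close>,
        which is extended to a field \<open>Y\<close> so that the assumption on pairs of fields
        applies.\<close>
      obtain h where h: "h \<in> H p" "push p h = push p s" using horizontal_lift[OF p] .
      obtain Y where Y: "Y \<in> horizontal_fields M N F" "Y p = h" using horizontal_extension[OF p h(1)] .
      have "smooth_vf M (pts M) Y" using Y unfolding horizontal_fields_def by simp
      from second_form_mean_curvature[OF openin_topspace p this, of X] assms[OF X Y(1) p] h(2) Y(2)
      have "metric N (F p) (DF p (X p) H2) (push p s) = - (?l p * metric M p (X p) h)"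
        by (simp add: mult.commute)
      then show "metric N (F p) (push p (- ?l p *\<^sub>R X p)) (push p s) = metric N (F p) (DF p (X p) H2) (push p s)"
        using horizontal_push(1)[OF p XH, of h] h(2)
        by (simp add: linear_cmul[OF lin] linear_neg[OF lin] bilinear_lneg[OF bil] bilinear_lmul[OF bil])
    qed
    then show ?thesis
      by (simp add: shape_operator_def linear_cmul[OF lin] linear_neg[OF lin])
  qed
  moreover have "smooth_fun M (pts M) ?l"
    by (rule smooth_metric_along[OF openin_topspace mean_curvature_smooth mean_curvature_smooth])
  ultimately show ?thesis unfolding pseudo_umbilical_def by blast
qed

end

theorem proposition3p1:
  fixes M1 :: "('a, 'n::euclidean_space) riem"
    and M2 :: "('b, 'm::euclidean_space) riem"
    and F :: "'a \<Rightarrow> 'b"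
    and D1 :: "'a \<Rightarrow> 'n \<Rightarrow> ('a \<Rightarrow> 'n) \<Rightarrow> 'n"
    and D2 :: "'b \<Rightarrow> 'm \<Rightarrow> ('b \<Rightarrow> 'm) \<Rightarrow> 'm"
    and DF :: "'a \<Rightarrow> 'n \<Rightarrow> ('a \<Rightarrow> 'm) \<Rightarrow> 'm"
    and m2 :: nat
    and H2 :: "'a \<Rightarrow> 'm"
  assumes "riemannian_manifold M1" and "riemannian_manifold M2"
    and "riemannian_map M1 M2 F"
    and "\<And>p. p \<in> pts M1 \<Longrightarrow> map_rank M1 M2 F p = m2"
    and "levi_civita M1 D1" and "levi_civita M2 D2"
    and "pullback_connection M1 M2 F D2 DF"
    and "H2 = mean_curvature M1 M2 F D1 DF m2"
  shows "pseudo_umbilical M1 M2 F D1 DF m2 \<longleftrightarrow>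
    (\<forall>X\<in>horizontal_fields M1 M2 F. \<forall>Y\<in>horizontal_fields M1 M2 F. \<forall>p\<in>pts M1.
       metric M2 (F p) (second_form M1 M2 F D1 DF X Y p) (H2 p)
         = metric M1 p (X p) (Y p) * metric M2 (F p) (H2 p) (H2 p))"
proof -
  interpret riemannian_map_data M1 M2 F D2 DF D1 m2
    using assms by unfold_locales (auto simp: riemannian_manifold_def riemannian_map_def)
  show ?thesis
    unfolding assms(8)
  proof
    assume "pseudo_umbilical M1 M2 F D1 DF m2"
    then show "\<forall>X\<in>horizontal_fields M1 M2 F. \<forall>Y\<in>horizontal_fields M1 M2 F. \<forall>p\<in>pts M1.
       metric M2 (F p) (second_form M1 M2 F D1 DF X Y p) (mean_curvature M1 M2 F D1 DF m2 p)
         = metric M1 p (X p) (Y p) *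
           metric M2 (F p) (mean_curvature M1 M2 F D1 DF m2 p) (mean_curvature M1 M2 F D1 DF m2 p)"
      unfolding pseudo_umbilical_def using pseudo_umbilical_imp by blast
  qed (intro pseudo_umbilicalI, blast)
qed

end
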